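(* Let $(Y,L,A,Z,U)$ and the potential outcomes $Y_{z,a}, Y_a$ ($z,a\in\{-1,1\}$) be as in the context, and suppose the following hold in addition to the standing assumptions listed there: (i) (Latent unconfoundedness) $Y_{z,a}$ is conditionally independent of $(Z,A)$ given $(L,U)$, for $z,a=\pm1$; (ii) (IV relevance) $Z$ and $A$ are not conditionally independent given $L$, in the sense that $\delta(L)\neq 0$ almost surely; (iii) (Exclusion restriction) $Y_{z,a}=Y_a$ almost surely, for $z,a=\pm 1$; (iv) (IV independence) $Z$ is conditionally independent of $U$ given $L$; (v) (IV positivity) $0<\Pr(Z=1\mid L)<1$ almost surely. Consider the two optimization problems over treatment regimes $\mathcal D$: $$\text{(P1)}\quad \arg\max_{\mathcal D} E\left[\frac{Z\,A\,Y\,I\{A=\mathcal D(L)\}}{\delta(L) f(Z\mid L)}\right],\qquad \text{(P2)}\quad \arg\max_{\mathcal D} E\left[\frac{Y\,I\{Z=\mathcal D(L)\}}{\delta(L) f(Z\mid L)}\right].$$ Then, for each of (P1) and (P2), the problem identifies the optimal treatment regime $\mathcal D^*(L)=\operatorname{sign}\{\gamma(L)\}$ (i.e. $\mathcal D^*$ is its maximizer, unique up to almost sure equality of $\mathcal D(L)$) if and only if $$E\left(\frac{\widetilde\gamma(L,U)}{\gamma(L)}\times\frac{\widetilde\delta(L,U)}{\delta(L)}\,\Big|\,L\right)>0\quad\text{almost surely}.$$ Moreover, this condition is equivalent to $$\operatorname{Cov}\left(\frac{\widetilde\gamma(L,U)}{\gamma(L)},\frac{\widetilde\delta(L,U)}{\delta(L)}\,\Big|\,L\right)>-1\quad\text{almost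 surely}.$$
   Context: Setting. On a probability space, $Y$ is a real-valued outcome (larger is better), $A\in\{-1,1\}$ is a binary treatment, $Z\in\{-1,1\}$ is a binary instrumental variable (IV), $L$ is a vector of observed covariates, and $U$ is an unmeasured confounder ($L$ and $U$ take values in standard Borel spaces). For $z,a\in\{-1,1\}$, $Y_{z,a}$ is the (real-valued) potential outcome had the IV and treatment been set to $z$ and $a$; $Y_a$ is the potential outcome had the treatment been set to $a$. Standing assumptions. Consistency: $Y=Y_{Z,A}$ and $Y=Y_A$ almost surely. Positivity: $\Pr(A=a\mid L)>0$ almost surely for $a=\pm1$. The potential outcomes are integrable, and the random variables inside the expectations in (P1) and (P2) are integrable for every regime. Notation. - $f(z\mid L)=\Pr(Z=z\mid L)$, and $f(Z\mid L)$ is this function evaluated at $z=Z$. $I\{\cdot\}$ is the indicator function. - $\delta(L)=\Pr(A=1\mid Z=1,L)-\Pr(A=1\mid Z=-1,L)$. - $\widetilde\delta(L,U)=\Pr(A=1\mid Z=1,L,U)-\Pr(A=1\mid Z=-1,L,U)$. - $\gamma(L)=E(Y_1-Y_{-1}\mid L)$ (the conditional average treatment effect), assumed nonzero almost surely. - $\widetilde\gamma(L,U)=E(Y_1-Y_{-1}\mid L,U)$. - A treatment regime is a measurable map $\mathcal D$ from the covariate space to $\{-1,1\}$. Set $Y_{\mathcal D(L)}=Y_1 I\{\mathcal D(L)=1\}+Y_{-1}I\{\mathcal D(L)=-1\}$. The optimal treatment regime $\mathcal D^*$ maximizes $E[Y_{\mathcal D(L)}]$ over all regimes; equivalently $\mathcal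 D^*(L)=\operatorname{sign}\{\gamma(L)\}$. - $\operatorname{Cov}(\cdot,\cdot\mid L)$ denotes conditional covariance given $L$. *)

theory Defs
  imports "HOL-Probability.Probability"
begin

text \<open>
  Conditioning on a random variable \<open>X\<close> means conditioning on the sigma-algebra it generates.
  The library's \<^const>\<open>real_cond_exp\<close> is the difference of the conditional expectations of the
  positive and negative parts, so it is the right notion also for a function that is not
  integrable, provided that both parts have almost surely finite conditional expectation.  This
  matters for ratios such as the conditional effect given \<open>(L, U)\<close> divided by the one given
  \<open>L\<close>, whose numerator is integrable and whose denominator is a function of \<open>L\<close>.
\<close>

definition cond_E :: "'w measure \<Rightarrow> ('w \<Rightarrow> 'x::topological_space) \<Rightarrow> ('w \<Rightarrow> real) \<Rightarrow> 'w \<Rightarrow> real"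
  where "cond_E M X f = real_cond_exp M (vimage_algebra (space M) X borel) f"

definition cond_Pr :: "'w measure \<Rightarrow> ('w \<Rightarrow> 'x::topological_space) \<Rightarrow> ('w \<Rightarrow> bool) \<Rightarrow> 'w \<Rightarrow> real"
  where "cond_Pr M X P = cond_E M X (indicat_real {\<omega> \<in> space M. P \<omega>})"

text \<open>
  \<open>Pr(P | Q, X)\<close> for an event \<open>Q\<close>: the conditional counterpart of \<^const>\<open>cond_prob\<close>.  It is
  meaningful where \<open>Pr(Q | X) > 0\<close>.
\<close>

definition cond_Pr_given ::
  "'w measure \<Rightarrow> ('w \<Rightarrow> 'x::topological_space) \<Rightarrow> ('w \<Rightarrow> bool) \<Rightarrow> ('w \<Rightarrow> bool) \<Rightarrow> 'w \<Rightarrow> real"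
  where "cond_Pr_given M X P Q \<omega> = cond_Pr M X (\<lambda>\<omega>. P \<omega> \<and> Q \<omega>) \<omega> / cond_Pr M X Q \<omega>"

definition cond_Cov ::
  "'w measure \<Rightarrow> ('w \<Rightarrow> 'x::topological_space) \<Rightarrow> ('w \<Rightarrow> real) \<Rightarrow> ('w \<Rightarrow> real) \<Rightarrow> 'w \<Rightarrow> real"
  where "cond_Cov M X V W =
    cond_E M X (\<lambda>\<omega>. (V \<omega> - cond_E M X V \<omega>) * (W \<omega> - cond_E M X W \<omega>))"

definition cond_indep ::
  "'w measure \<Rightarrow> ('w \<Rightarrow> 'x::topological_space) \<Rightarrow>
   ('w \<Rightarrow> 'v::topological_space) \<Rightarrow> ('w \<Rightarrow> 't::topological_space) \<Rightarrow> bool"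
  where "cond_indep M X V W \<longleftrightarrow>
    (\<forall>S\<in>sets borel. \<forall>T\<in>sets borel. AE \<omega> in M.
       cond_Pr M X (\<lambda>\<omega>. V \<omega> \<in> S \<and> W \<omega> \<in> T) \<omega> =
       cond_Pr M X (\<lambda>\<omega>. V \<omega> \<in> S) \<omega> * cond_Pr M X (\<lambda>\<omega>. W \<omega> \<in> T) \<omega>)"

text \<open>
  The next two definitions are used both with \<open>X = L\<close> and with \<open>X = (L, U)\<close>.
\<close>

definition delta ::
  "'w measure \<Rightarrow> ('w \<Rightarrow> real) \<Rightarrow> ('w \<Rightarrow> real) \<Rightarrow> ('w \<Rightarrow> 'x::topological_space) \<Rightarrow> 'w \<Rightarrow> real"
  where "delta M A Z X \<omega> =
    cond_Pr_given M X (\<lambda>\<omega>. A \<omega> = 1) (\<lambda>\<omega>. Z \<omega> = 1) \<omega> -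
    cond_Pr_given M X (\<lambda>\<omega>. A \<omega> = 1) (\<lambda>\<omega>. Z \<omega> = -1) \<omega>"

definition gamma ::
  "'w measure \<Rightarrow> (real \<Rightarrow> 'w \<Rightarrow> real) \<Rightarrow> ('w \<Rightarrow> 'x::topological_space) \<Rightarrow> 'w \<Rightarrow> real"
  where "gamma M Ya X = cond_E M X (\<lambda>\<omega>. Ya 1 \<omega> - Ya (-1) \<omega>)"

text \<open>\<open>f(Z | L)\<close>: the function \<open>Pr(Z = z | L)\<close> of \<open>z\<close>, evaluated at the observed \<open>Z\<close>.\<close>

definition iv_prob ::
  "'w measure \<Rightarrow> ('w \<Rightarrow> real) \<Rightarrow> ('w \<Rightarrow> 'l::topological_space) \<Rightarrow> 'w \<Rightarrow> real"
  where "iv_prob M Z L \<omega> = cond_Pr M L (\<lambda>\<omega>'. Z \<omega>' = Z \<omega>) \<omega>"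

definition regimes :: "('l::topological_space \<Rightarrow> real) set"
  where "regimes = {D \<in> borel_measurable borel. \<forall>l. D l \<in> {-1, 1}}"

definition arg_maxima :: "(('l::topological_space \<Rightarrow> real) \<Rightarrow> real) \<Rightarrow> ('l \<Rightarrow> real) set"
  where "arg_maxima J = {D \<in> regimes. \<forall>D'\<in>regimes. J D' \<le> J D}"

definition regime_outcome ::
  "(real \<Rightarrow> 'w \<Rightarrow> real) \<Rightarrow> ('w \<Rightarrow> 'l) \<Rightarrow> ('l \<Rightarrow> real) \<Rightarrow> 'w \<Rightarrow> real"
  where "regime_outcome Ya L D \<omega> =
    Ya 1 \<omega> * of_bool (D (L \<omega>) = 1) + Ya (-1) \<omega> * of_bool (D (L \<omega>) = -1)"

definition optimal_regimes ::
  "'w measure \<Rightarrow> (real \<Rightarrow> 'w \<Rightarrow> real) \<Rightarrow> ('w \<Rightarrow> 'l::topological_space) \<Rightarrow> ('l \<Rightarrow> real) set"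
  where "optimal_regimes M Ya L = arg_maxima (\<lambda>D. LINT \<omega>|M. regime_outcome Ya L D \<omega>)"

definition P1_integrand ::
  "'w measure \<Rightarrow> ('w \<Rightarrow> real) \<Rightarrow> ('w \<Rightarrow> real) \<Rightarrow> ('w \<Rightarrow> real) \<Rightarrow>
   ('w \<Rightarrow> 'l::topological_space) \<Rightarrow> ('l \<Rightarrow> real) \<Rightarrow> 'w \<Rightarrow> real"
  where "P1_integrand M Y A Z L D \<omega> =
    Z \<omega> * A \<omega> * Y \<omega> * of_bool (A \<omega> = D (L \<omega>)) / (delta M A Z L \<omega> * iv_prob M Z L \<omega>)"

definition P2_integrand ::
  "'w measure \<Rightarrow> ('w \<Rightarrow> real) \<Rightarrow> ('w \<Rightarrow> real) \<Rightarrow> ('w \<Rightarrow> real) \<Rightarrow>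
   ('w \<Rightarrow> 'l::topological_space) \<Rightarrow> ('l \<Rightarrow> real) \<Rightarrow> 'w \<Rightarrow> real"
  where "P2_integrand M Y A Z L D \<omega> =
    Y \<omega> * of_bool (Z \<omega> = D (L \<omega>)) / (delta M A Z L \<omega> * iv_prob M Z L \<omega>)"

text \<open>
  Maximizing \<open>J\<close> over the regimes identifies the optimal regime \<open>D* (L) = sign (gamma(L))\<close>: it
  is a maximizer of \<open>J\<close>, and every maximizer of \<open>J\<close> agrees with it almost surely at \<open>L\<close>.
\<close>

definition identifies_optimal_regime ::
  "'w measure \<Rightarrow> (real \<Rightarrow> 'w \<Rightarrow> real) \<Rightarrow> ('w \<Rightarrow> 'l::topological_space) \<Rightarrow>
   (('l \<Rightarrow> real) \<Rightarrow> real) \<Rightarrow> bool"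
  where "identifies_optimal_regime M Ya L J \<longleftrightarrow>
    (\<exists>Dopt \<in> optimal_regimes M Ya L.
       (AE \<omega> in M. Dopt (L \<omega>) = sgn (gamma M Ya L \<omega>)) \<and>
       Dopt \<in> arg_maxima J \<and>
       (\<forall>D \<in> arg_maxima J. AE \<omega> in M. D (L \<omega>) = Dopt (L \<omega>)))"

end

theory Submission
  imports Defs
begin

text \<open>
  The objectives (P1) and (P2) both have the form \<open>E [X (D(L))]\<close>, and in both cases the contrast
  \<open>X 1 - X (-1)\<close> equals \<open>Z Y / (\<delta>(L) f(Z | L))\<close>.  A regime maximizes such an objective iff
  it agrees almost surely with the sign of \<open>E (X 1 - X (-1) | L)\<close> wherever this does not vanish;
  hence the objective identifies the optimal regime iff this conditional contrast has almost
  surely the (nonzero) sign of \<open>\<gamma>(L)\<close>.  Latent unconfoundedness and IV independence give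
  \<open>E (Y I{Z = z} | L, U) = f(z | L) \<Sum>a. E (Y_a | L, U) Pr(A = a | Z = z, L, U)\<close>, so that the
  conditional contrast is \<open>E (\<gamma>~(L, U) \<delta>~(L, U) | L) / \<delta>(L)\<close>.
  The covariance form follows because both ratios have conditional mean 1 given \<open>L\<close>.
\<close>

section \<open>Measure-theoretic tools: pulling out factors and comparing weighted integrals\<close>

lemma integrable_mult_bounded:
  fixes h k :: "'a \<Rightarrow> real"
  assumes h: "integrable M h" and k: "AE x in M. \<bar>k x\<bar> \<le> 1" and [measurable]: "k \<in> borel_measurable M"
  shows "integrable M (\<lambda>x. h x * k x)"
  using h k by (intro Bochner_Integration.integrable_bound[OF h])
    (auto simp: abs_mult intro!: mult_left_le)

text \<open>The product \<open>f x * g x\<close> may fail to be integrable, as happens for ratios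
  with an \<open>F\<close>-measurable denominator. The computation therefore runs in
  \<open>ennreal\<close>, where both parts of the product always have conditional expectations;
  finiteness of those of the two parts of \<open>g\<close> permits the return to the reals.\<close>

lemma (in sigma_finite_subalgebra) real_cond_exp_mult_F_meas:
  assumes f[measurable]: "f \<in> borel_measurable F" and g: "integrable M g"
  shows "AE x in M. real_cond_exp M F (\<lambda>x. f x * g x) x = f x * real_cond_exp M F g x"
proof -
  have g'[measurable]: "g \<in> borel_measurable M" using g by auto
  have fM[measurable]: "f \<in> borel_measurable M" by (rule measurable_from_subalg[OF subalg f])
  have split: "AE x in M. nn_cond_exp M F (\<lambda>x. ennreal (f x * h x)) x =
      ennreal (f x) * nn_cond_exp M F (\<lambda>x. ennreal (h x)) x +
      ennreal (- f x) * nn_cond_exp M F (\<lambda>x. ennreal (- h x)) x"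
    if [measurable]: "h \<in> borel_measurable M" for h
  proof -
    \<comment> \<open>Since \<open>ennreal\<close> sends negative reals to 0,
      \<open>ennreal a\<close> and \<open>ennreal (- a)\<close> are the positive and negative parts
      of \<open>a\<close>, at most one of them nonzero.\<close>
    have "ennreal (a * b) = ennreal a * ennreal b + ennreal (- a) * ennreal (- b)" for a b :: real
    proof (cases "a \<ge> 0")
      case True
      then show ?thesis by (simp add: ennreal_mult' ennreal_neg)
    next
      case False
      then have "ennreal (- a) * ennreal (- b) = ennreal ((- a) * (- b))"
        by (intro ennreal_mult'[symmetric]) auto
      with False show ?thesis by (simp add: ennreal_neg)
    qed
    then have eq: "(\<lambda>x. ennreal (f x * h x)) =
        (\<lambda>x. ennreal (f x) * ennreal (h x) + ennreal (- f x) * ennreal (- h x))"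
      by auto
    have "AE x in M. nn_cond_exp M F (\<lambda>x. ennreal (f x) * ennreal (h x)) x +
        nn_cond_exp M F (\<lambda>x. ennreal (- f x) * ennreal (- h x)) x =
        nn_cond_exp M F (\<lambda>x. ennreal (f x * h x)) x"
      unfolding eq by (rule nn_cond_exp_sum) auto
    moreover have "AE x in M. ennreal (f x) * nn_cond_exp M F (\<lambda>x. ennreal (h x)) x =
        nn_cond_exp M F (\<lambda>x. ennreal (f x) * ennreal (h x)) x"
      by (rule nn_cond_exp_prod) auto
    moreover have "AE x in M. ennreal (- f x) * nn_cond_exp M F (\<lambda>x. ennreal (- h x)) x =
        nn_cond_exp M F (\<lambda>x. ennreal (- f x) * ennreal (- h x)) x"
      by (rule nn_cond_exp_prod) auto
    ultimately show ?thesis by eventually_elim simp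
  qed
  have fin: "AE x in M. nn_cond_exp M F (\<lambda>x. ennreal (h x)) x \<noteq> \<infinity>"
    if h: "integrable M h" for h
  proof -
    have [measurable]: "h \<in> borel_measurable M" using h by auto
    have "(\<integral>\<^sup>+ x. nn_cond_exp M F (\<lambda>x. ennreal (h x)) x \<partial>M) = (\<integral>\<^sup>+ x. ennreal (h x) \<partial>M)"
      using nn_cond_exp_intg[of "\<lambda>_. 1" "\<lambda>x. ennreal (h x)"] by simp
    also have "\<dots> \<noteq> \<infinity>" using h by (auto simp: real_integrable_def)
    finally show ?thesis by (intro nn_integral_PInf_AE) auto
  qed
  have gm: "integrable M (\<lambda>x. - g x)" using g by simp
  \<comment> \<open>The negative part of the product is the positive part of \<open>f\<close> times
    \<open>- g\<close>.\<close>
  have "AE x in M. nn_cond_exp M F (\<lambda>x. ennreal (- (f x * g x))) x =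
      ennreal (f x) * nn_cond_exp M F (\<lambda>x. ennreal (- g x)) x +
      ennreal (- f x) * nn_cond_exp M F (\<lambda>x. ennreal (g x)) x"
    using split[of "\<lambda>x. - g x"] by simp
  with split[OF g'] fin[OF g] fin[OF gm] show ?thesis
  proof eventually_elim
    case (elim x)
    let ?p = "nn_cond_exp M F (\<lambda>x. ennreal (g x)) x"
    let ?m = "nn_cond_exp M F (\<lambda>x. ennreal (- g x)) x"
    obtain p m where p: "p \<ge> 0" "?p = ennreal p" and m: "m \<ge> 0" "?m = ennreal m"
      using elim(2,3) by (metis ennreal_cases infinity_ennreal_def)
    \<comment> \<open>The sign of \<open>f x\<close> leaves one summand in each part, and in both
      cases the difference of the parts is \<open>f x * (p - m)\<close>.\<close>
    show ?case
    proof (cases "f x \<ge> 0")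
      case True
      then have "ennreal (- f x) = 0" by (simp add: ennreal_neg)
      with True elim p m show ?thesis
        by (simp add: real_cond_exp_def enn2real_mult algebra_simps)
    next
      case False
      then have "ennreal (f x) = 0" by (simp add: ennreal_neg)
      with False elim p m show ?thesis
        by (simp add: real_cond_exp_def enn2real_mult algebra_simps)
    qed
  qed
qed

text \<open>Pushing the densities \<open>p\<close> and \<open>q\<close> forward along
  \<open>V\<close> gives two finite measures on \<open>N\<close>. They agree on a pi-system
  containing the whole space, hence coincide, and so do the integrals of any measurable
  \<open>g\<close>, including a non-integrable one, whose integral has the same default value under
  both.\<close>

lemma integral_weighted_eqI:
  fixes p q :: "'a \<Rightarrow> real" and g :: "'b \<Rightarrow> real"
  assumes p: "integrable M p" "AE x in M. 0 \<le> p x"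
    and q: "integrable M q" "AE x in M. 0 \<le> q x"
    and V[measurable]: "V \<in> measurable M N"
    and E: "Int_stable E" "sets N = sigma_sets (space N) E" "space N \<in> E"
    and eq: "\<And>S. S \<in> E \<Longrightarrow>
      (\<integral>x. p x * indicator S (V x) \<partial>M) = (\<integral>x. q x * indicator S (V x) \<partial>M)"
    and g[measurable]: "g \<in> borel_measurable N"
  shows "(\<integral>x. p x * g (V x) \<partial>M) = (\<integral>x. q x * g (V x) \<partial>M)"
proof -
  have [measurable]: "p \<in> borel_measurable M" "q \<in> borel_measurable M" using p q by auto
  have EN: "S \<in> sets N" if "S \<in> E" for S
    using E(2) that by (simp add: sigma_sets.Basic)
  have em: "emeasure (distr (density M (\<lambda>x. ennreal (r x))) N V) S =
      ennreal (\<integral>x. r x * indicator S (V x) \<partial>M)"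
    if r: "integrable M r" "AE x in M. 0 \<le> r x" and S[measurable]: "S \<in> sets N" for r :: "'a \<Rightarrow> real" and S
  proof -
    have [measurable]: "r \<in> borel_measurable M" using r by auto
    have int: "integrable M (\<lambda>x. r x * indicator S (V x))"
      by (rule Bochner_Integration.integrable_bound[OF r(1)]) (auto simp: indicator_def)
    have "emeasure (distr (density M (\<lambda>x. ennreal (r x))) N V) S =
        (\<integral>\<^sup>+ x. ennreal (r x) * indicator (V -` S \<inter> space M) x \<partial>M)"
      by (simp add: emeasure_distr emeasure_density)
    also have "\<dots> = (\<integral>\<^sup>+ x. ennreal (r x * indicator S (V x)) \<partial>M)"
      by (intro nn_integral_cong) (auto simp: indicator_def)
    also have "\<dots> = ennreal (\<integral>x. r x * indicator S (V x) \<partial>M)"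
      using r(2) by (intro nn_integral_eq_integral int) (auto simp: indicator_def)
    finally show ?thesis .
  qed
  \<comment> \<open>The cover demanded by the uniqueness theorem is the constant sequence
    \<open>space N\<close>, of finite measure because the weights are integrable.\<close>
  have "distr (density M (\<lambda>x. ennreal (p x))) N V = distr (density M (\<lambda>x. ennreal (q x))) N V"
  proof (rule measure_eqI_generator_eq[OF E(1), where \<Omega> = "space N" and A = "\<lambda>_. space N"])
    show "E \<subseteq> Pow (space N)" using EN sets.sets_into_space by blast
  qed (use E em[OF p] em[OF q] eq EN in \<open>auto simp: ennreal_less_top\<close>)
  then have "(\<integral>y. g y \<partial>distr (density M (\<lambda>x. ennreal (p x))) N V) =
      (\<integral>y. g y \<partial>distr (density M (\<lambda>x. ennreal (q x))) N V)" by simp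
  then show ?thesis
    using p(2) q(2) by (simp add: integral_distr integral_density)
qed

section \<open>Consequences of conditional independence\<close>

context finite_measure_subalgebra
begin

lemma real_cond_exp_indicator_bounds:
  assumes "B \<in> sets M"
  shows "AE x in M. 0 \<le> real_cond_exp M F (indicat_real B) x"
    and "AE x in M. real_cond_exp M F (indicat_real B) x \<le> 1"
proof -
  have i: "integrable M (indicat_real B)"
    using assms by (simp add: integrable_indicator_iff less_top[symmetric])
  show "AE x in M. 0 \<le> real_cond_exp M F (indicat_real B) x"
    by (rule real_cond_exp_ge_c[OF i]) auto
  show "AE x in M. real_cond_exp M F (indicat_real B) x \<le> 1"
    by (rule real_cond_exp_le_c[OF i]) (auto simp: indicator_def)
qed

text \<open>Conditioning on \<open>F\<close> factorizes the two events; undoing the conditioning for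
  \<open>B'\<close> alone leaves \<open>B\<close> replaced by its conditional probability. In this
  one-sided form the independence can be tested on a generator.\<close>

lemma integral_indicator_cond_indep:
  assumes B: "B \<in> sets M" and B': "B' \<in> sets M" and C: "C \<in> sets F"
    and indep: "AE x in M. real_cond_exp M F (indicat_real (B' \<inter> B)) x =
      real_cond_exp M F (indicat_real B') x * real_cond_exp M F (indicat_real B) x"
  shows "(\<integral>x. indicat_real C x * indicat_real B x * indicat_real B' x \<partial>M) =
    (\<integral>x. indicat_real C x * real_cond_exp M F (indicat_real B) x * indicat_real B' x \<partial>M)"
proof -
  have [measurable]: "B \<in> sets M" "B' \<in> sets M" "C \<in> sets F" using B B' C by auto
  have [measurable]: "C \<in> sets M" using C subalg by (auto simp: subalgebra_def)
  let ?q = "real_cond_exp M F (indicat_real B)"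
  note bd = real_cond_exp_indicator_bounds[OF B]
  have "(\<integral>x. indicat_real C x * indicat_real B x * indicat_real B' x \<partial>M) =
      (\<integral>x. indicat_real C x * indicat_real (B' \<inter> B) x \<partial>M)"
    by (intro Bochner_Integration.integral_cong) (auto simp: indicator_def)
  also have "\<dots> = (\<integral>x. indicat_real C x * real_cond_exp M F (indicat_real (B' \<inter> B)) x \<partial>M)"
    by (intro real_cond_exp_intg(2)[symmetric] integrable_const_bound[of _ 1])
      (auto simp: indicator_def)
  also have "\<dots> = (\<integral>x. (indicat_real C x * ?q x) * real_cond_exp M F (indicat_real B') x \<partial>M)"
    using indep by (intro integral_cong_AE) auto
  also have "\<dots> = (\<integral>x. indicat_real C x * ?q x * indicat_real B' x \<partial>M)"
    using bd by (intro real_cond_exp_intg(2) integrable_const_bound[of _ 1])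
      (auto simp: indicator_def)
  finally show ?thesis .
qed

text \<open>Conditional independence speaks of events only. The passage to an integrable
  \<open>Y\<close> compares the law of \<open>Y\<close> under two weights, \<open>B\<close> itself
  and its conditional probability, both restricted to a set \<open>C\<close> of
  \<open>F\<close>.\<close>

lemma real_cond_exp_indicator_mult_cond_indep:
  fixes Y :: "'a \<Rightarrow> real"
  assumes Y: "integrable M Y" and B: "B \<in> sets M"
    and indep: "\<And>S. S \<in> sets borel \<Longrightarrow> AE x in M.
      real_cond_exp M F (indicat_real ((Y -` S \<inter> space M) \<inter> B)) x =
      real_cond_exp M F (indicat_real (Y -` S \<inter> space M)) x * real_cond_exp M F (indicat_real B) x"
  shows "AE x in M. real_cond_exp M F (\<lambda>x. indicat_real B x * Y x) x =
    real_cond_exp M F (indicat_real B) x * real_cond_exp M F Y x"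
proof -
  let ?q = "real_cond_exp M F (indicat_real B)"
  have [measurable]: "B \<in> sets M" "Y \<in> borel_measurable M" using B Y by auto
  note bd = real_cond_exp_indicator_bounds[OF B]
  have qY: "integrable M (\<lambda>x. ?q x * Y x)"
    using bd by (intro Bochner_Integration.integrable_bound[OF Y])
      (auto simp: abs_mult intro!: mult_left_le_one_le)
  note intq = real_cond_exp_intg[OF qY]
  show ?thesis
  proof (rule real_cond_exp_charact)
    fix C assume C[measurable]: "C \<in> sets F"
    have [measurable]: "C \<in> sets M" using C subalg by (auto simp: subalgebra_def)
    have CY: "integrable M (\<lambda>x. (indicat_real C x * ?q x) * Y x)"
      using bd by (intro Bochner_Integration.integrable_bound[OF Y])
        (auto simp: abs_mult indicator_def intro!: mult_left_le_one_le)
    have "(\<integral>x\<in>C. indicat_real B x * Y x \<partial>M) =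
        (\<integral>x. (indicat_real C x * indicat_real B x) * Y x \<partial>M)"
      by (simp add: set_lebesgue_integral_def mult.assoc)
    \<comment> \<open>Taking \<open>g\<close> to be the identity turns agreement of the two weighted
      laws of \<open>Y\<close> into agreement of their means.\<close>
    also have "\<dots> = (\<integral>x. (indicat_real C x * ?q x) * Y x \<partial>M)"
    proof (rule integral_weighted_eqI[where N = borel and E = "sets borel" and g = "\<lambda>y. y"])
      show "integrable M (\<lambda>x. indicat_real C x * indicat_real B x)"
        "integrable M (\<lambda>x. indicat_real C x * ?q x)"
        using bd by (auto intro!: integrable_const_bound[of _ 1] simp: indicator_def)
      fix S :: "real set" assume S: "S \<in> sets borel"
      have S': "Y -` S \<inter> space M \<in> sets M" using S by measurable
      have eq: "(\<integral>x. h x * indicator S (Y x) \<partial>M) = (\<integral>x. h x * indicat_real (Y -` S \<inter> space M) x \<partial>M)"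
        for h :: "'a \<Rightarrow> real"
        by (intro Bochner_Integration.integral_cong) (auto simp: indicator_def)
      show "(\<integral>x. indicat_real C x * indicat_real B x * indicator S (Y x) \<partial>M) =
          (\<integral>x. indicat_real C x * ?q x * indicator S (Y x) \<partial>M)"
        unfolding eq by (rule integral_indicator_cond_indep[OF B S' C indep[OF S]])
    qed (use bd sets.sigma_sets_eq[of borel] sets.Int_stable[of borel] in \<open>auto simp: indicator_def\<close>)
    also have "\<dots> = (\<integral>x. (indicat_real C x * ?q x) * real_cond_exp M F Y x \<partial>M)"
      by (rule real_cond_exp_intg(2)[symmetric, OF CY]) auto
    also have "\<dots> = (\<integral>x\<in>C. ?q x * real_cond_exp M F Y x \<partial>M)"
      by (simp add: set_lebesgue_integral_def mult.assoc)
    finally show "(\<integral>x\<in>C. indicat_real B x * Y x \<partial>M) = (\<integral>x\<in>C. ?q x * real_cond_exp M F Y x \<partial>M)" .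
  next
    show "integrable M (\<lambda>x. indicat_real B x * Y x)"
      using integrable_mult_indicator[OF B Y] by simp
    show "integrable M (\<lambda>x. ?q x * real_cond_exp M F Y x)" by (rule intq(1)) auto
  qed auto
qed

end

lemma (in finite_measure) finite_measure_subalgebra_vimage_algebra:
  assumes "X \<in> measurable M N"
  shows "finite_measure_subalgebra M (vimage_algebra (space M) X N)"
proof
  show "subalgebra M (vimage_algebra (space M) X N)"
    using assms measurable_space[OF assms]
    by (auto simp: subalgebra_def sets_vimage_algebra2 Pi_iff)
qed

text \<open>Given \<open>L\<close>, the variable \<open>U\<close> carries no further information on
  \<open>B\<close>. The defining property of the conditional expectation given the pair has to be
  checked on all events generated by the pair; the rectangles form a pi-system, and on a rectangle
  it is the factorization over \<open>L\<close>.\<close>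

lemma (in finite_measure) real_cond_exp_vimage_algebra_pair:
  assumes L[measurable]: "L \<in> measurable M N1" and U[measurable]: "U \<in> measurable M N2"
    and B[measurable]: "B \<in> sets M"
    and indep: "\<And>T. T \<in> sets N2 \<Longrightarrow> AE x in M.
      real_cond_exp M (vimage_algebra (space M) L N1) (indicat_real ((U -` T \<inter> space M) \<inter> B)) x =
      real_cond_exp M (vimage_algebra (space M) L N1) (indicat_real (U -` T \<inter> space M)) x *
      real_cond_exp M (vimage_algebra (space M) L N1) (indicat_real B) x"
  shows "AE x in M.
    real_cond_exp M (vimage_algebra (space M) (\<lambda>x. (L x, U x)) (N1 \<Otimes>\<^sub>M N2)) (indicat_real B) x =
    real_cond_exp M (vimage_algebra (space M) L N1) (indicat_real B) x"
proof -
  let ?F = "vimage_algebra (space M) L N1" and ?LU = "\<lambda>x. (L x, U x)"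
  let ?G = "vimage_algebra (space M) ?LU (N1 \<Otimes>\<^sub>M N2)"
  interpret F: finite_measure_subalgebra M ?F
    by (rule finite_measure_subalgebra_vimage_algebra) measurable
  interpret G: finite_measure_subalgebra M ?G
    by (rule finite_measure_subalgebra_vimage_algebra) measurable
  let ?q = "real_cond_exp M ?F (indicat_real B)"
  let ?E = "{a \<times> b | a b. a \<in> sets N1 \<and> b \<in> sets N2}"
  note bd = F.real_cond_exp_indicator_bounds[OF B]
  have q: "integrable M ?q" using bd by (intro integrable_const_bound[of _ 1]) auto
  have LUG: "?LU \<in> measurable ?G (N1 \<Otimes>\<^sub>M N2)"
    using measurable_space[OF L] measurable_space[OF U]
    by (intro measurable_vimage_algebra1) (auto simp: space_pair_measure)
  then have LG: "L \<in> measurable ?G N1"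
    using measurable_comp[OF LUG measurable_fst] by (simp add: comp_def)
  show ?thesis
  proof (rule G.real_cond_exp_charact)
    fix C assume "C \<in> sets ?G"
    then obtain T where T[measurable]: "T \<in> sets (N1 \<Otimes>\<^sub>M N2)" and C: "C = ?LU -` T \<inter> space M"
      using measurable_space[OF L] measurable_space[OF U]
      by (subst (asm) sets_vimage_algebra2) (auto simp: space_pair_measure)
    \<comment> \<open>Written as an indicator of \<open>T\<close> at the pair, the domain
      \<open>C\<close> becomes the function \<open>g\<close> of the weighted comparison, with
      weights \<open>B\<close> and \<open>?q\<close>.\<close>
    have set_int: "(\<integral>x\<in>C. h x \<partial>M) = (\<integral>x. h x * indicat_real T (?LU x) \<partial>M)" for h :: "'a \<Rightarrow> real"
      unfolding set_lebesgue_integral_def C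
      by (intro Bochner_Integration.integral_cong) (auto simp: indicator_def)
    show "(\<integral>x\<in>C. indicat_real B x \<partial>M) = (\<integral>x\<in>C. ?q x \<partial>M)"
      unfolding set_int
    proof (rule integral_weighted_eqI[where N = "N1 \<Otimes>\<^sub>M N2" and E = ?E])
      fix S assume "S \<in> ?E"
      then obtain a b where S: "S = a \<times> b" and ab[measurable]: "a \<in> sets N1" "b \<in> sets N2" by auto
      have a: "L -` a \<inter> space M \<in> sets ?F" using ab by (simp add: in_vimage_algebra)
      have b: "U -` b \<inter> space M \<in> sets M" by measurable
      have eq: "(\<integral>x. h x * indicat_real S (?LU x) \<partial>M) =
          (\<integral>x. indicat_real (L -` a \<inter> space M) x * h x * indicat_real (U -` b \<inter> space M) x \<partial>M)"
        for h :: "'a \<Rightarrow> real"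
        by (intro Bochner_Integration.integral_cong) (auto simp: indicator_def S)
      show "(\<integral>x. indicat_real B x * indicat_real S (?LU x) \<partial>M) =
          (\<integral>x. ?q x * indicat_real S (?LU x) \<partial>M)"
        unfolding eq by (rule F.integral_indicator_cond_indep[OF B b a indep]) measurable
    next
      show "space (N1 \<Otimes>\<^sub>M N2) \<in> ?E" by (auto simp: space_pair_measure)
    qed (use q bd Int_stable_pair_measure_generator[of N1 N2] in
        \<open>auto simp: sets_pair_measure space_pair_measure integrable_indicator_iff less_top[symmetric]\<close>)
  next
    \<comment> \<open>Preimages under \<open>?q\<close> are preimages under \<open>L\<close>, and
      \<open>L\<close> is a component of the pair.\<close>
    show "?q \<in> borel_measurable ?G"
      unfolding measurable_def
    proof safe
      fix S :: "real set" assume "S \<in> sets borel"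
      then have "?q -` S \<inter> space ?F \<in> sets ?F" by (rule measurable_sets[rotated]) measurable
      then obtain a where "a \<in> sets N1" "?q -` S \<inter> space M = L -` a \<inter> space M"
        using measurable_space[OF L] by (auto simp: sets_vimage_algebra2)
      then show "?q -` S \<inter> space ?G \<in> sets ?G"
        using measurable_sets[OF LG, of a] by simp
    qed auto
  qed (use q in \<open>auto simp: integrable_indicator_iff less_top[symmetric]\<close>)
qed

section \<open>Maximizers over regimes and identification\<close>

text \<open>For arbitrary arms \<open>X 1\<close> and \<open>X (-1)\<close>, with
  \<open>gamma M X L\<close> as their conditional contrast, the objective is a constant plus the
  mean of the contrast over the treated region. Treating exactly where the contrast is positive is
  best, and the choice is free where it vanishes. The generality in \<open>X\<close> serves the true
  outcomes and the weighted integrands alike.\<close>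

lemma arg_maxima_regime_outcome_iff:
  fixes L :: "'w \<Rightarrow> 'l::topological_space" and X :: "real \<Rightarrow> 'w \<Rightarrow> real"
  assumes "finite_measure M" and L[measurable]: "L \<in> borel_measurable M"
    and X: "integrable M (X 1)" "integrable M (X (-1))"
  shows "D \<in> arg_maxima (\<lambda>D. LINT \<omega>|M. regime_outcome X L D \<omega>) \<longleftrightarrow> D \<in> regimes \<and>
    (AE \<omega> in M. (gamma M X L \<omega> > 0 \<longrightarrow> D (L \<omega>) = 1) \<and> (gamma M X L \<omega> < 0 \<longrightarrow> D (L \<omega>) = -1))"
proof -
  interpret finite_measure M by fact
  let ?F = "vimage_algebra (space M) L borel"
  interpret F: finite_measure_subalgebra M ?F
    by (rule finite_measure_subalgebra_vimage_algebra) measurable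
  define C where "C = gamma M X L"
  define J where "J = (\<lambda>D. LINT \<omega>|M. regime_outcome X L D \<omega>)"
  have X12: "integrable M (\<lambda>\<omega>. X 1 \<omega> - X (-1) \<omega>)" using X by simp
  have C: "C = real_cond_exp M ?F (\<lambda>\<omega>. X 1 \<omega> - X (-1) \<omega>)"
    by (simp add: C_def gamma_def cond_E_def)
  have CF[measurable]: "C \<in> borel_measurable ?F" and [measurable]: "C \<in> borel_measurable M"
    by (simp_all add: C)
  have Cint: "integrable M C" unfolding C by (rule F.real_cond_exp_int(1)[OF X12])
  have LF[measurable]: "L \<in> measurable ?F borel"
    by (rule measurable_vimage_algebra1) simp
  have Jeq: "J D = (LINT \<omega>|M. X (-1) \<omega>) + (LINT \<omega>|M. of_bool (D (L \<omega>) = 1) * C \<omega>)"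
    and Dint: "integrable M (\<lambda>\<omega>. of_bool (D (L \<omega>) = 1) * C \<omega>)" if D: "D \<in> regimes" for D
  proof -
    have [measurable]: "D \<in> borel_measurable borel" using D by (simp add: regimes_def)
    have [measurable]: "(\<lambda>\<omega>. of_bool (D (L \<omega>) = 1) :: real) \<in> borel_measurable ?F"
      "(\<lambda>\<omega>. of_bool (D (L \<omega>) = 1) :: real) \<in> borel_measurable M" by measurable
    have bnd: "integrable M (\<lambda>\<omega>. of_bool (D (L \<omega>) = 1) * h \<omega>)" if "integrable M h" for h :: "'w \<Rightarrow> real"
      using that by (intro Bochner_Integration.integrable_bound[OF that]) auto
    show "integrable M (\<lambda>\<omega>. of_bool (D (L \<omega>) = 1) * C \<omega>)" by (rule bnd[OF Cint])
    have dich: "D l = 1 \<or> D l = -1" for l using D by (auto simp: regimes_def)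
    have "J D = (LINT \<omega>|M. X (-1) \<omega> + of_bool (D (L \<omega>) = 1) * (X 1 \<omega> - X (-1) \<omega>))"
      unfolding J_def regime_outcome_def
    proof (intro Bochner_Integration.integral_cong refl)
      fix \<omega>
      show "X 1 \<omega> * of_bool (D (L \<omega>) = 1) + X (- 1) \<omega> * of_bool (D (L \<omega>) = - 1) =
        X (- 1) \<omega> + of_bool (D (L \<omega>) = 1) * (X 1 \<omega> - X (- 1) \<omega>)"
        using dich[of "L \<omega>"] by auto
    qed
    also have "\<dots> = (LINT \<omega>|M. X (-1) \<omega>) + (LINT \<omega>|M. of_bool (D (L \<omega>) = 1) * (X 1 \<omega> - X (-1) \<omega>))"
      by (intro Bochner_Integration.integral_add X bnd X12)
    \<comment> \<open>The treated region is an event of \<open>?F\<close>, so the contrast may be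
      replaced by its conditional expectation.\<close>
    also have "(LINT \<omega>|M. of_bool (D (L \<omega>) = 1) * (X 1 \<omega> - X (-1) \<omega>)) =
        (LINT \<omega>|M. of_bool (D (L \<omega>) = 1) * C \<omega>)"
      unfolding C using X by (intro F.real_cond_exp_intg(2)[symmetric] bnd X12) auto
    finally show "J D = (LINT \<omega>|M. X (-1) \<omega>) + (LINT \<omega>|M. of_bool (D (L \<omega>) = 1) * C \<omega>)" .
  qed
  \<comment> \<open>A regime lives on the covariate space, so the event must first be written as the
    preimage under \<open>L\<close> of a Borel set.\<close>
  have "{\<omega> \<in> space ?F. C \<omega> > 0} \<in> sets ?F" by measurable
  then obtain S where S[measurable]: "S \<in> sets borel" and SC: "{\<omega> \<in> space M. C \<omega> > 0} = L -` S \<inter> space M"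
    by (auto simp: sets_vimage_algebra2)
  define Dopt :: "'l \<Rightarrow> real" where "Dopt = (\<lambda>l. if l \<in> S then 1 else -1)"
  have Dopt: "Dopt \<in> regimes" by (auto simp: regimes_def Dopt_def)
  have Dopt1: "Dopt (L \<omega>) = 1 \<longleftrightarrow> C \<omega> > 0" if "\<omega> \<in> space M" for \<omega>
    using SC that by (auto simp: Dopt_def)
  have gap: "J D \<le> J Dopt \<and> (J D = J Dopt \<longleftrightarrow>
      (AE \<omega> in M. (C \<omega> > 0 \<longrightarrow> D (L \<omega>) = 1) \<and> (C \<omega> < 0 \<longrightarrow> D (L \<omega>) = -1)))"
    if D: "D \<in> regimes" for D
  proof -
    \<comment> \<open>This loss equals the absolute value of \<open>C\<close> where \<open>D\<close>
      disagrees with \<open>Dopt\<close>, and 0 elsewhere; its integral vanishes iff disagreement is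
      confined to \<open>C = 0\<close> up to a null set.\<close>
    let ?g = "\<lambda>\<omega>. of_bool (Dopt (L \<omega>) = 1) * C \<omega> - of_bool (D (L \<omega>) = 1) * C \<omega>"
    have gi: "integrable M ?g" by (intro Bochner_Integration.integrable_diff Dint D Dopt)
    have nonneg: "AE \<omega> in M. 0 \<le> ?g \<omega>"
      by (intro AE_I2) (auto simp: Dopt1)
    have eq: "J Dopt - J D = (LINT \<omega>|M. ?g \<omega>)"
      by (simp add: Jeq D Dopt Dint)
    have dich: "D l = 1 \<or> D l = -1" for l using D by (auto simp: regimes_def)
    have "J D = J Dopt \<longleftrightarrow> (LINT \<omega>|M. ?g \<omega>) = 0" using eq by linarith
    also have "\<dots> \<longleftrightarrow> (AE \<omega> in M. ?g \<omega> = 0)"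
      by (rule integral_nonneg_eq_0_iff_AE[OF gi nonneg])
    also have "\<dots> \<longleftrightarrow> (AE \<omega> in M. (C \<omega> > 0 \<longrightarrow> D (L \<omega>) = 1) \<and> (C \<omega> < 0 \<longrightarrow> D (L \<omega>) = -1))"
    proof (rule AE_cong)
      fix \<omega> assume "\<omega> \<in> space M"
      then show "?g \<omega> = 0 \<longleftrightarrow> (C \<omega> > 0 \<longrightarrow> D (L \<omega>) = 1) \<and> (C \<omega> < 0 \<longrightarrow> D (L \<omega>) = -1)"
        using Dopt1[of \<omega>] dich[of "L \<omega>"] by (auto simp: not_less)
    qed
    finally show ?thesis using eq integral_nonneg_AE[OF nonneg] by auto
  qed
  have "D \<in> arg_maxima J \<longleftrightarrow> D \<in> regimes \<and> J D = J Dopt"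
    unfolding arg_maxima_def mem_Collect_eq using gap Dopt by (metis order_antisym)
  then show ?thesis using gap by (auto simp: J_def C_def)
qed

text \<open>Being a maximizer forces the sign of the contrast of \<open>X\<close> to agree with that
  of \<open>Ya\<close> wherever the former is nonzero; uniqueness forces it to be nonzero. A
  positive product of the two contrasts expresses both.\<close>

lemma identifies_optimal_regime_iff:
  fixes L :: "'w \<Rightarrow> 'l::topological_space" and X Ya :: "real \<Rightarrow> 'w \<Rightarrow> real"
  assumes fin: "finite_measure M" and L[measurable]: "L \<in> borel_measurable M"
    and X: "integrable M (X 1)" "integrable M (X (-1))"
    and Ya: "integrable M (Ya 1)" "integrable M (Ya (-1))"
    and nz: "AE \<omega> in M. gamma M Ya L \<omega> \<noteq> 0"
  shows "identifies_optimal_regime M Ya L (\<lambda>D. LINT \<omega>|M. regime_outcome X L D \<omega>) \<longleftrightarrow>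
    (AE \<omega> in M. gamma M X L \<omega> * gamma M Ya L \<omega> > 0)"
proof -
  interpret finite_measure M by fact
  let ?F = "vimage_algebra (space M) L borel"
  define C where "C = gamma M X L"
  define G where "G = gamma M Ya L"
  let ?J = "\<lambda>D. LINT \<omega>|M. regime_outcome X L D \<omega>"
  note maxX = arg_maxima_regime_outcome_iff[of M L X, OF fin L X, folded C_def]
  note maxY = arg_maxima_regime_outcome_iff[of M L Ya, OF fin L Ya, folded G_def optimal_regimes_def]
  have nz: "AE \<omega> in M. G \<omega> \<noteq> 0" using nz by (simp add: G_def)
  have [measurable]: "C \<in> borel_measurable ?F" "G \<in> borel_measurable ?F"
    by (simp_all add: C_def G_def gamma_def cond_E_def)
  have regimes_range: "D l = 1 \<or> D l = -1" if "D \<in> regimes" for D :: "'l \<Rightarrow> real" and l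
    using that by (auto simp: regimes_def)
  show ?thesis
    unfolding C_def[symmetric] G_def[symmetric]
  proof
    assume "identifies_optimal_regime M Ya L ?J"
    then obtain Dopt where D: "Dopt \<in> arg_maxima ?J" "Dopt \<in> optimal_regimes M Ya L"
      and sg: "AE \<omega> in M. Dopt (L \<omega>) = sgn (G \<omega>)"
      and uniq: "\<And>D. D \<in> arg_maxima ?J \<Longrightarrow> AE \<omega> in M. D (L \<omega>) = Dopt (L \<omega>)"
      unfolding identifies_optimal_regime_def G_def by blast
    have "{\<omega> \<in> space ?F. C \<omega> = 0} \<in> sets ?F" by measurable
    then obtain S where S[measurable]: "S \<in> sets borel" and SC: "{\<omega> \<in> space M. C \<omega> = 0} = L -` S \<inter> space M"
      by (auto simp: sets_vimage_algebra2)
    \<comment> \<open>Flipping the optimal regime where the contrast of \<open>X\<close> vanishes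
      yields another maximizer. Since the flip changes the value, uniqueness makes that region
      null.\<close>
    define D' where "D' = (\<lambda>l. if l \<in> S then - Dopt l else Dopt l)"
    have Dr: "Dopt \<in> regimes" and Dae: "AE \<omega> in M. (C \<omega> > 0 \<longrightarrow> Dopt (L \<omega>) = 1) \<and> (C \<omega> < 0 \<longrightarrow> Dopt (L \<omega>) = -1)"
      using D(1) by (auto simp: maxX)
    have [measurable]: "Dopt \<in> borel_measurable borel" using Dr by (simp add: regimes_def)
    have "D' \<in> regimes" using regimes_range[OF Dr] by (auto simp: regimes_def D'_def)
    moreover have "AE \<omega> in M. (C \<omega> > 0 \<longrightarrow> D' (L \<omega>) = 1) \<and> (C \<omega> < 0 \<longrightarrow> D' (L \<omega>) = -1)"
      using Dae AE_space
    proof eventually_elim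
      case (elim \<omega>)
      then have "L \<omega> \<in> S \<longleftrightarrow> C \<omega> = 0" using SC by auto
      then show ?case using elim by (auto simp: D'_def)
    qed
    ultimately have "AE \<omega> in M. D' (L \<omega>) = Dopt (L \<omega>)" by (intro uniq) (simp add: maxX)
    then show "AE \<omega> in M. C \<omega> * G \<omega> > 0"
      using Dae sg nz AE_space
    proof eventually_elim
      case (elim \<omega>)
      then have "L \<omega> \<notin> S" using regimes_range[OF Dr, of "L \<omega>"] by (auto simp: D'_def)
      then have "C \<omega> \<noteq> 0" using SC elim by auto
      then show ?case using elim by (auto simp: sgn_if zero_less_mult_iff split: if_splits)
    qed
  next
    assume pos: "AE \<omega> in M. C \<omega> * G \<omega> > 0"
    have "{\<omega> \<in> space ?F. G \<omega> > 0} \<in> sets ?F" by measurable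
    then obtain S where S[measurable]: "S \<in> sets borel" and SG: "{\<omega> \<in> space M. G \<omega> > 0} = L -` S \<inter> space M"
      by (auto simp: sets_vimage_algebra2)
    \<comment> \<open>A version of the sign of \<open>G\<close> as a function of the covariate; the
      value -1 off \<open>S\<close> is correct almost surely because \<open>G\<close> is almost
      surely nonzero.\<close>
    define Dopt :: "'l \<Rightarrow> real" where "Dopt = (\<lambda>l. if l \<in> S then 1 else -1)"
    have Dopt: "Dopt \<in> regimes" by (auto simp: regimes_def Dopt_def)
    have sg: "AE \<omega> in M. Dopt (L \<omega>) = sgn (G \<omega>)"
      using nz AE_space by eventually_elim (use SG in \<open>auto simp: Dopt_def sgn_if\<close>)
    have "AE \<omega> in M. (G \<omega> > 0 \<longrightarrow> Dopt (L \<omega>) = 1) \<and> (G \<omega> < 0 \<longrightarrow> Dopt (L \<omega>) = -1)"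
      using sg by eventually_elim auto
    then have "Dopt \<in> optimal_regimes M Ya L" using Dopt by (simp add: maxY)
    moreover have "Dopt \<in> arg_maxima ?J"
    proof -
      have "AE \<omega> in M. (C \<omega> > 0 \<longrightarrow> Dopt (L \<omega>) = 1) \<and> (C \<omega> < 0 \<longrightarrow> Dopt (L \<omega>) = -1)"
        using sg pos by eventually_elim (auto simp: zero_less_mult_iff)
      then show ?thesis using Dopt by (simp add: maxX)
    qed
    moreover have "AE \<omega> in M. D (L \<omega>) = Dopt (L \<omega>)" if "D \<in> arg_maxima ?J" for D
    proof -
      from that have "AE \<omega> in M. (C \<omega> > 0 \<longrightarrow> D (L \<omega>) = 1) \<and> (C \<omega> < 0 \<longrightarrow> D (L \<omega>) = -1)"
        by (simp add: maxX)
      then show ?thesis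
        using sg pos by eventually_elim (auto simp: zero_less_mult_iff)
    qed
    ultimately show "identifies_optimal_regime M Ya L ?J"
      unfolding identifies_optimal_regime_def using sg by (auto simp: G_def)
  qed
qed

section \<open>Ratios of conditional mean one and their covariance\<close>

context finite_measure_subalgebra
begin

text \<open>The ratios \<open>V\<close> and \<open>W\<close> may fail to be integrable, so the
  covariance is not expanded in them. Everything is done with products of \<open>v\<close>,
  \<open>v0\<close> by \<open>w\<close>, \<open>w0\<close>, which are integrable because
  \<open>w\<close>, and with it \<open>w0\<close>, is bounded by 1; the factor
  \<open>1 / (v0 x * w0 x)\<close> is pulled out only at the end.\<close>

lemma real_cond_exp_ratio_covariance:
  assumes v: "integrable M v" and w: "integrable M w" and w1: "AE x in M. \<bar>w x\<bar> \<le> 1"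
    and [measurable]: "v0 \<in> borel_measurable F" "w0 \<in> borel_measurable F"
    and v0E: "AE x in M. real_cond_exp M F v x = v0 x"
    and w0E: "AE x in M. real_cond_exp M F w x = w0 x"
    and nz: "AE x in M. v0 x \<noteq> 0" "AE x in M. w0 x \<noteq> 0"
  defines "V \<equiv> \<lambda>x. v x / v0 x" and "W \<equiv> \<lambda>x. w x / w0 x"
  shows "AE x in M. real_cond_exp M F (\<lambda>x. V x * W x) x =
      real_cond_exp M F (\<lambda>x. v x * w x) x / (v0 x * w0 x)" (is ?prod)
    and "AE x in M. real_cond_exp M F
        (\<lambda>x. (V x - real_cond_exp M F V x) * (W x - real_cond_exp M F W x)) x =
      real_cond_exp M F (\<lambda>x. v x * w x) x / (v0 x * w0 x) - 1" (is ?cov)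
proof -
  have [measurable]: "v \<in> borel_measurable M" "w \<in> borel_measurable M" using v w by auto
  have [measurable]: "v0 \<in> borel_measurable M" "w0 \<in> borel_measurable M"
    by (rule measurable_from_subalg[OF subalg], measurable)+
  have v0: "integrable M v0"
    by (rule integrable_cong_AE_imp[OF real_cond_exp_int(1)[OF v] _ v0E]) measurable
  have w01: "AE x in M. \<bar>w0 x\<bar> \<le> 1"
    using real_cond_exp_ge_c[OF w, of "-1"] real_cond_exp_le_c[OF w, of 1] w1 w0E
    by (auto simp: abs_le_iff)
  have vw: "integrable M (\<lambda>x. v x * w x)" and vw0: "integrable M (\<lambda>x. v x * w0 x)"
    and v0w: "integrable M (\<lambda>x. v0 x * w x)" and v0w0: "integrable M (\<lambda>x. v0 x * w0 x)"
    by (intro integrable_mult_bounded v v0 w1 w01; measurable)+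
  have V1: "AE x in M. real_cond_exp M F V x = 1"
    using real_cond_exp_mult_F_meas[OF _ v, of "\<lambda>x. 1 / v0 x"] nz v0E
    by (auto simp: V_def)
  have W1: "AE x in M. real_cond_exp M F W x = 1"
    using real_cond_exp_mult_F_meas[OF _ w, of "\<lambda>x. 1 / w0 x"] nz w0E
    by (auto simp: W_def)
  show ?prod
    using real_cond_exp_mult_F_meas[OF _ vw, of "\<lambda>x. 1 / (v0 x * w0 x)"]
    by (simp add: V_def W_def)
  \<comment> \<open>This is \<open>(v x - v0 x) * (w x - w0 x)\<close> expanded into four integrable
    terms; three of them have conditional mean \<open>v0 x * w0 x\<close>.\<close>
  let ?c = "\<lambda>x. (v x * w x - v x * w0 x) - (v0 x * w x - v0 x * w0 x)"
  have c: "integrable M ?c"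
    by (intro Bochner_Integration.integrable_diff vw vw0 v0w v0w0)
  have cE: "AE x in M. real_cond_exp M F ?c x = real_cond_exp M F (\<lambda>x. v x * w x) x - v0 x * w0 x"
  proof -
    have "AE x in M. real_cond_exp M F ?c x =
        real_cond_exp M F (\<lambda>x. v x * w x - v x * w0 x) x - real_cond_exp M F (\<lambda>x. v0 x * w x - v0 x * w0 x) x"
      by (intro real_cond_exp_diff Bochner_Integration.integrable_diff vw vw0 v0w v0w0)
    moreover have "AE x in M. real_cond_exp M F (\<lambda>x. v x * w x - v x * w0 x) x =
        real_cond_exp M F (\<lambda>x. v x * w x) x - real_cond_exp M F (\<lambda>x. v x * w0 x) x"
      by (intro real_cond_exp_diff vw vw0)
    moreover have "AE x in M. real_cond_exp M F (\<lambda>x. v0 x * w x - v0 x * w0 x) x =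
        real_cond_exp M F (\<lambda>x. v0 x * w x) x - real_cond_exp M F (\<lambda>x. v0 x * w0 x) x"
      by (intro real_cond_exp_diff v0w v0w0)
    moreover have "AE x in M. real_cond_exp M F (\<lambda>x. v x * w0 x) x = w0 x * v0 x"
      using real_cond_exp_mult_F_meas[OF _ v, of w0] v0E by (auto simp: mult.commute)
    moreover have "AE x in M. real_cond_exp M F (\<lambda>x. v0 x * w x) x = v0 x * w0 x"
      using real_cond_exp_mult_F_meas[OF _ w, of v0] w0E by auto
    moreover have "AE x in M. real_cond_exp M F (\<lambda>x. v0 x * w0 x) x = v0 x * w0 x"
      by (intro real_cond_exp_F_meas v0w0) measurable
    ultimately show ?thesis by eventually_elim (simp add: algebra_simps)
  qed
  have "AE x in M. real_cond_exp M F
        (\<lambda>x. (V x - real_cond_exp M F V x) * (W x - real_cond_exp M F W x)) x =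
      real_cond_exp M F (\<lambda>x. 1 / (v0 x * w0 x) * ?c x) x"
  proof (rule real_cond_exp_cong)
    show "AE x in M. (V x - real_cond_exp M F V x) * (W x - real_cond_exp M F W x) =
        1 / (v0 x * w0 x) * ?c x"
      using V1 W1 nz
      by eventually_elim (simp add: V_def W_def field_simps)
  qed (auto simp: V_def W_def)
  moreover have "AE x in M. real_cond_exp M F (\<lambda>x. 1 / (v0 x * w0 x) * ?c x) x =
      1 / (v0 x * w0 x) * real_cond_exp M F ?c x"
    by (rule real_cond_exp_mult_F_meas[OF _ c]) measurable
  ultimately show ?cov
    using cE nz by eventually_elim (simp add: field_simps)
qed

end

section \<open>The latent IV model and its conditional probabilities\<close>

locale latent_iv_model = prob_space M
  for M :: "'w measure" +
  fixes Y A Z :: "'w \<Rightarrow> real"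
    and L :: "'w \<Rightarrow> 'l::polish_space" and U :: "'w \<Rightarrow> 'u::polish_space"
    and Yza :: "real \<Rightarrow> real \<Rightarrow> 'w \<Rightarrow> real" and Ya :: "real \<Rightarrow> 'w \<Rightarrow> real"
  assumes Y[measurable]: "Y \<in> borel_measurable M"
    and L[measurable]: "L \<in> borel_measurable M"
    and U[measurable]: "U \<in> borel_measurable M"
    and A[measurable]: "A \<in> borel_measurable M" and A_values: "\<forall>\<omega>\<in>space M. A \<omega> \<in> {-1, 1}"
    and Z[measurable]: "Z \<in> borel_measurable M" and Z_values: "\<forall>\<omega>\<in>space M. Z \<omega> \<in> {-1, 1}"
    and Yza_integrable: "\<forall>z\<in>{-1, 1}. \<forall>a\<in>{-1, 1}. integrable M (Yza z a)"
    and Ya_integrable: "\<forall>a\<in>{-1, 1}. integrable M (Ya a)"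
    and consistency: "AE \<omega> in M. Y \<omega> = Yza (Z \<omega>) (A \<omega>) \<omega>"
    and latent_unconfoundedness: "\<forall>z\<in>{-1, 1}. \<forall>a\<in>{-1, 1}.
      cond_indep M (\<lambda>\<omega>. (L \<omega>, U \<omega>)) (Yza z a) (\<lambda>\<omega>. (Z \<omega>, A \<omega>))"
    and exclusion_restriction: "\<forall>z\<in>{-1, 1}. \<forall>a\<in>{-1, 1}. AE \<omega> in M. Yza z a \<omega> = Ya a \<omega>"
    and iv_independence: "cond_indep M L Z U"
    and iv_positivity:
      "AE \<omega> in M. 0 < cond_Pr M L (\<lambda>\<omega>. Z \<omega> = 1) \<omega> \<and> cond_Pr M L (\<lambda>\<omega>. Z \<omega> = 1) \<omega> < 1"
begin

abbreviation "LU \<equiv> \<lambda>\<omega>. (L \<omega>, U \<omega>)"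
abbreviation "FL \<equiv> vimage_algebra (space M) L borel"
abbreviation "FLU \<equiv> vimage_algebra (space M) LU borel"

sublocale FL: finite_measure_subalgebra M FL
  by (rule finite_measure_subalgebra_vimage_algebra) measurable

sublocale FLU: finite_measure_subalgebra M FLU
  by (rule finite_measure_subalgebra_vimage_algebra) measurable

lemma FL_subalgebra_FLU: "subalgebra FLU FL"
  unfolding subalgebra_def
proof
  have "LU \<in> measurable FLU borel" by (rule measurable_vimage_algebra1) simp
  then have "(\<lambda>\<omega>. fst (LU \<omega>)) \<in> measurable FLU borel"
    by (rule measurable_compose) (rule borel_measurable_continuous_onI, intro continuous_intros)
  then have "L \<in> measurable FLU borel" by simp
  then show "sets FL \<subseteq> sets FLU"
    using measurable_sets[of L FLU borel] by (auto simp: sets_vimage_algebra2)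
qed simp

text \<open>Only \<open>f\<close> conditions on \<open>L\<close> alone. IV independence will
  identify \<open>r\<close> with \<open>f\<close>, so that \<open>q\<close> factors into
  \<open>f\<close> and the latent propensity \<open>p\<close>; the weight \<open>1 / f\<close> then
  cancels the first factor.\<close>

abbreviation f where "f z \<equiv> cond_Pr M L (\<lambda>\<omega>. Z \<omega> = z)"
abbreviation r where "r z \<equiv> cond_Pr M LU (\<lambda>\<omega>. Z \<omega> = z)"
abbreviation q where "q a z \<equiv> cond_Pr M LU (\<lambda>\<omega>. A \<omega> = a \<and> Z \<omega> = z)"
abbreviation p where "p z \<equiv> cond_Pr_given M LU (\<lambda>\<omega>. A \<omega> = 1) (\<lambda>\<omega>. Z \<omega> = z)"
abbreviation mu where "mu a \<equiv> cond_E M LU (Ya a)"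

lemma cond_Pr_measurable[measurable]:
  "cond_Pr M L P \<in> borel_measurable FL" "cond_Pr M L P \<in> borel_measurable M"
  "cond_Pr M LU P \<in> borel_measurable FLU" "cond_Pr M LU P \<in> borel_measurable M"
  "cond_E M L h \<in> borel_measurable FL" "cond_E M L h \<in> borel_measurable M"
  "cond_E M LU h \<in> borel_measurable FLU" "cond_E M LU h \<in> borel_measurable M"
  by (simp_all add: cond_Pr_def cond_E_def)

lemma delta_measurable[measurable]:
  "delta M A Z L \<in> borel_measurable FL" "delta M A Z L \<in> borel_measurable M"
  "delta M A Z LU \<in> borel_measurable M" "p z \<in> borel_measurable M"
  unfolding delta_def[abs_def] cond_Pr_given_def[abs_def] by measurable

lemma integrable_indicator_event:
  "Measurable.pred M P \<Longrightarrow> integrable M (indicat_real {\<omega> \<in> space M. P \<omega>})"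
  by (simp add: integrable_indicator_iff less_top[symmetric])

lemma binary_values: "(1::real) \<in> {-1, 1}" "(-1::real) \<in> {-1, 1}"
  by auto

lemma f_sum: "AE \<omega> in M. f 1 \<omega> + f (-1) \<omega> = 1"
proof -
  let ?I = "\<lambda>z. indicat_real {\<omega> \<in> space M. Z \<omega> = z}"
  have "AE \<omega> in M. real_cond_exp M FL (\<lambda>\<omega>. ?I 1 \<omega> + ?I (-1) \<omega>) \<omega> = f 1 \<omega> + f (-1) \<omega>"
    unfolding cond_Pr_def cond_E_def
    by (intro FL.real_cond_exp_add integrable_indicator_event) measurable
  moreover have "AE \<omega> in M. real_cond_exp M FL (\<lambda>\<omega>. ?I 1 \<omega> + ?I (-1) \<omega>) \<omega> = real_cond_exp M FL (\<lambda>_. 1) \<omega>"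
    using Z_values by (intro FL.real_cond_exp_cong AE_I2) (auto simp: indicator_def)
  moreover have "AE \<omega> in M. real_cond_exp M FL (\<lambda>_. 1) \<omega> = 1"
    by (rule FL.real_cond_exp_F_meas) auto
  ultimately show ?thesis by eventually_elim simp
qed

lemma f_pos: "z \<in> {-1, 1} \<Longrightarrow> AE \<omega> in M. 0 < f z \<omega>"
  using iv_positivity f_sum by (auto elim: eventually_elim2)

text \<open>By IV independence \<open>U\<close> adds nothing on \<open>Z\<close> once
  \<open>L\<close> is known, which makes the observable weight correct also at the latent
  level.\<close>

lemma r_eq_f: "AE \<omega> in M. r z \<omega> = f z \<omega>"
proof -
  have "AE \<omega> in M. real_cond_exp M (vimage_algebra (space M) LU (borel \<Otimes>\<^sub>M borel))
      (indicat_real {\<omega> \<in> space M. Z \<omega> = z}) \<omega> =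
    real_cond_exp M FL (indicat_real {\<omega> \<in> space M. Z \<omega> = z}) \<omega>"
  proof (rule real_cond_exp_vimage_algebra_pair)
    fix T :: "'u set" assume T: "T \<in> sets borel"
    have e: "U -` T \<inter> space M \<inter> {\<omega> \<in> space M. Z \<omega> = z} = {\<omega> \<in> space M. Z \<omega> \<in> {z} \<and> U \<omega> \<in> T}"
      "U -` T \<inter> space M = {\<omega> \<in> space M. U \<omega> \<in> T}" "{\<omega> \<in> space M. Z \<omega> = z} = {\<omega> \<in> space M. Z \<omega> \<in> {z}}"
      by auto
    have "AE \<omega> in M. cond_Pr M L (\<lambda>\<omega>. Z \<omega> \<in> {z} \<and> U \<omega> \<in> T) \<omega> =
        cond_Pr M L (\<lambda>\<omega>. Z \<omega> \<in> {z}) \<omega> * cond_Pr M L (\<lambda>\<omega>. U \<omega> \<in> T) \<omega>"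
      by (rule iv_independence[unfolded cond_indep_def, THEN bspec, THEN bspec, OF _ T]) simp
    then show "AE \<omega> in M. real_cond_exp M FL (indicat_real (U -` T \<inter> space M \<inter> {\<omega> \<in> space M. Z \<omega> = z})) \<omega> =
        real_cond_exp M FL (indicat_real (U -` T \<inter> space M)) \<omega> *
        real_cond_exp M FL (indicat_real {\<omega> \<in> space M. Z \<omega> = z}) \<omega>"
      unfolding e(1) unfolding e(2) unfolding e(3) cond_Pr_def cond_E_def by (simp add: mult.commute)
  qed measurable
  \<comment> \<open>On second countable spaces the Borel sets of the product are the product
    sigma-algebra, so conditioning on the pair agrees with conditioning on
    \<open>LU\<close>.\<close>
  then show ?thesis by (simp add: borel_prod cond_Pr_def cond_E_def)
qed

lemma q_nonneg: "AE \<omega> in M. 0 \<le> q a z \<omega>"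
  unfolding cond_Pr_def cond_E_def by (rule FLU.real_cond_exp_indicator_bounds) measurable

lemma q_sum: "AE \<omega> in M. q 1 z \<omega> + q (-1) z \<omega> = r z \<omega>"
proof -
  let ?I = "\<lambda>a. indicat_real {\<omega> \<in> space M. A \<omega> = a \<and> Z \<omega> = z}"
  have "AE \<omega> in M. real_cond_exp M FLU (\<lambda>\<omega>. ?I 1 \<omega> + ?I (-1) \<omega>) \<omega> = q 1 z \<omega> + q (-1) z \<omega>"
    unfolding cond_Pr_def cond_E_def
    by (intro FLU.real_cond_exp_add integrable_indicator_event) measurable
  moreover have "AE \<omega> in M. real_cond_exp M FLU (\<lambda>\<omega>. ?I 1 \<omega> + ?I (-1) \<omega>) \<omega> = r z \<omega>"
    unfolding cond_Pr_def cond_E_def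
    using A_values by (intro FLU.real_cond_exp_cong AE_I2) (auto simp: indicator_def)
  ultimately show ?thesis by eventually_elim simp
qed

text \<open>The denominator of \<open>p\<close> is \<open>r\<close>, which equals the positive
  \<open>f\<close>; the joint probabilities of the two treatments add up to it.\<close>

lemma q_eq:
  assumes "z \<in> {-1, 1}"
  shows "AE \<omega> in M. q 1 z \<omega> = f z \<omega> * p z \<omega> \<and> q (-1) z \<omega> = f z \<omega> * (1 - p z \<omega>)"
    and "AE \<omega> in M. 0 \<le> p z \<omega> \<and> p z \<omega> \<le> 1"
proof -
  have *: "AE \<omega> in M. 0 < f z \<omega> \<and> f z \<omega> = q 1 z \<omega> + q (-1) z \<omega> \<and> p z \<omega> = q 1 z \<omega> / f z \<omega>"
    using f_pos[OF assms] r_eq_f[of z] q_sum[of z]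
    by eventually_elim (simp add: cond_Pr_given_def)
  show "AE \<omega> in M. q 1 z \<omega> = f z \<omega> * p z \<omega> \<and> q (-1) z \<omega> = f z \<omega> * (1 - p z \<omega>)"
    using * by eventually_elim (auto simp: field_simps)
  show "AE \<omega> in M. 0 \<le> p z \<omega> \<and> p z \<omega> \<le> 1"
    using * q_nonneg[of 1 z] q_nonneg[of "-1" z] by eventually_elim (auto simp: field_simps)
qed

lemma p_integrable: "z \<in> {-1, 1} \<Longrightarrow> integrable M (p z)"
  using q_eq(2)[of z] by (intro integrable_const_bound[of _ 1]) auto

text \<open>In general one would have to average \<open>p\<close> over the law of \<open>U\<close>
  given \<open>Z\<close> and \<open>L\<close>. Here \<open>p\<close> is the joint probability
  divided by the \<open>L\<close>-measurable \<open>f\<close>, so the tower property and the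
  pull-out rule suffice.\<close>

lemma cond_E_p:
  assumes z: "z \<in> {-1, 1}"
  shows "AE \<omega> in M. cond_E M L (p z) \<omega> = cond_Pr_given M L (\<lambda>\<omega>. A \<omega> = 1) (\<lambda>\<omega>. Z \<omega> = z) \<omega>"
proof -
  have "AE \<omega> in M. real_cond_exp M FL (q 1 z) \<omega> = cond_Pr M L (\<lambda>\<omega>. A \<omega> = 1 \<and> Z \<omega> = z) \<omega>"
    unfolding cond_Pr_def cond_E_def
    by (intro FL.real_cond_exp_nested_subalg FLU.subalg FL_subalgebra_FLU integrable_indicator_event)
      measurable
  moreover have "AE \<omega> in M. real_cond_exp M FL (q 1 z) \<omega> = real_cond_exp M FL (\<lambda>\<omega>. f z \<omega> * p z \<omega>) \<omega>"
    using q_eq(1)[OF z] by (intro FL.real_cond_exp_cong) auto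
  moreover have "AE \<omega> in M. real_cond_exp M FL (\<lambda>\<omega>. f z \<omega> * p z \<omega>) \<omega> = f z \<omega> * cond_E M L (p z) \<omega>"
    unfolding cond_E_def[of M L "p z"]
    by (rule FL.real_cond_exp_mult_F_meas[OF _ p_integrable[OF z]]) measurable
  ultimately show ?thesis
    using f_pos[OF z] by eventually_elim (simp add: cond_Pr_given_def field_simps)
qed

lemma delta_LU_bounded: "AE \<omega> in M. \<bar>delta M A Z LU \<omega>\<bar> \<le> 1"
  using q_eq(2)[OF binary_values(1)] q_eq(2)[OF binary_values(2)]
  by eventually_elim (auto simp: delta_def)

lemma delta_LU_integrable: "integrable M (delta M A Z LU)"
  using delta_LU_bounded by (intro integrable_const_bound[of _ 1]) auto

lemma cond_E_delta_LU: "AE \<omega> in M. cond_E M L (delta M A Z LU) \<omega> = delta M A Z L \<omega>"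
proof -
  have "AE \<omega> in M. cond_E M L (delta M A Z LU) \<omega> = cond_E M L (p 1) \<omega> - cond_E M L (p (-1)) \<omega>"
    unfolding cond_E_def[of M L] delta_def
    by (intro FL.real_cond_exp_diff p_integrable) auto
  then show ?thesis
    using cond_E_p[OF binary_values(1)] cond_E_p[OF binary_values(2)]
    by eventually_elim (simp add: delta_def)
qed

lemma mu_integrable: "a \<in> {-1, 1} \<Longrightarrow> integrable M (mu a)"
  unfolding cond_E_def using Ya_integrable by (intro FLU.real_cond_exp_int) auto

lemma gamma_LU_eq: "AE \<omega> in M. gamma M Ya LU \<omega> = mu 1 \<omega> - mu (-1) \<omega>"
  unfolding gamma_def cond_E_def using Ya_integrable by (intro FLU.real_cond_exp_diff) auto

lemma gamma_LU_integrable: "integrable M (gamma M Ya LU)"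
  unfolding gamma_def cond_E_def using Ya_integrable
  by (intro FLU.real_cond_exp_int Bochner_Integration.integrable_diff) auto

lemma cond_E_gamma_LU: "AE \<omega> in M. cond_E M L (gamma M Ya LU) \<omega> = gamma M Ya L \<omega>"
  unfolding gamma_def cond_E_def using Ya_integrable
  by (intro FL.real_cond_exp_nested_subalg FLU.subalg FL_subalgebra_FLU
      Bochner_Integration.integrable_diff) auto

section \<open>Conditional means of the outcome and of the weighted contrast\<close>

text \<open>Latent unconfoundedness, applied to the singleton event \<open>(Z, A) = (z, a)\<close>,
  splits off \<open>q\<close>; exclusion then removes the dependence of the remaining mean on
  \<open>z\<close>.\<close>

lemma cond_E_indicator_Yza:
  assumes z: "z \<in> {-1, 1}" and a: "a \<in> {-1, 1}"
  shows "AE \<omega> in M. cond_E M LU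
      (\<lambda>\<omega>. indicat_real {\<omega> \<in> space M. A \<omega> = a \<and> Z \<omega> = z} \<omega> * Yza z a \<omega>) \<omega> = q a z \<omega> * mu a \<omega>"
proof -
  let ?B = "{\<omega> \<in> space M. A \<omega> = a \<and> Z \<omega> = z}"
  have int: "integrable M (Yza z a)" "integrable M (Ya a)"
    using Yza_integrable Ya_integrable z a by auto
  have "AE \<omega> in M. real_cond_exp M FLU (\<lambda>\<omega>. indicat_real ?B \<omega> * Yza z a \<omega>) \<omega> =
      real_cond_exp M FLU (indicat_real ?B) \<omega> * real_cond_exp M FLU (Yza z a) \<omega>"
  proof (rule FLU.real_cond_exp_indicator_mult_cond_indep[OF int(1)])
    fix S :: "real set" assume S: "S \<in> sets borel"
    have "AE \<omega> in M. cond_Pr M LU (\<lambda>\<omega>. Yza z a \<omega> \<in> S \<and> (Z \<omega>, A \<omega>) \<in> {(z, a)}) \<omega> =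
        cond_Pr M LU (\<lambda>\<omega>. Yza z a \<omega> \<in> S) \<omega> * cond_Pr M LU (\<lambda>\<omega>. (Z \<omega>, A \<omega>) \<in> {(z, a)}) \<omega>"
      by (rule latent_unconfoundedness[unfolded cond_indep_def,
            THEN bspec, THEN bspec, THEN bspec, THEN bspec, OF z a S]) simp
    moreover have "{\<omega> \<in> space M. Yza z a \<omega> \<in> S \<and> (Z \<omega>, A \<omega>) \<in> {(z, a)}} = (Yza z a -` S \<inter> space M) \<inter> ?B"
      "{\<omega> \<in> space M. Yza z a \<omega> \<in> S} = Yza z a -` S \<inter> space M"
      "{\<omega> \<in> space M. (Z \<omega>, A \<omega>) \<in> {(z, a)}} = ?B" by auto
    ultimately show "AE \<omega> in M. real_cond_exp M FLU (indicat_real ((Yza z a -` S \<inter> space M) \<inter> ?B)) \<omega> =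
        real_cond_exp M FLU (indicat_real (Yza z a -` S \<inter> space M)) \<omega> *
        real_cond_exp M FLU (indicat_real ?B) \<omega>"
      by (simp only: cond_Pr_def cond_E_def)
  qed measurable
  moreover have "AE \<omega> in M. real_cond_exp M FLU (Yza z a) \<omega> = real_cond_exp M FLU (Ya a) \<omega>"
    using exclusion_restriction z a int by (intro FLU.real_cond_exp_cong) auto
  ultimately show ?thesis
    by eventually_elim (simp add: cond_Pr_def cond_E_def)
qed

lemma mixture_integrable:
  assumes z: "z \<in> {-1, 1}"
  shows "integrable M (\<lambda>\<omega>. mu 1 \<omega> * p z \<omega> + mu (-1) \<omega> * (1 - p z \<omega>))"
  using q_eq(2)[OF z]
  by (intro Bochner_Integration.integrable_add integrable_mult_bounded mu_integrable) auto

text \<open>Consistency splits the outcome on \<open>Z = z\<close> by treatment arm, which also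
  transfers integrability from the potential outcomes. The mixture of \<open>mu 1\<close> and
  \<open>mu (-1)\<close> with weights \<open>p\<close> and \<open>1 - p\<close> is the mean outcome
  given \<open>Z = z\<close> at the latent level.\<close>

lemma cond_E_indicator_Y:
  assumes z: "z \<in> {-1, 1}"
  shows "integrable M (\<lambda>\<omega>. indicat_real {\<omega> \<in> space M. Z \<omega> = z} \<omega> * Y \<omega>)"
    and "AE \<omega> in M. cond_E M L (\<lambda>\<omega>. indicat_real {\<omega> \<in> space M. Z \<omega> = z} \<omega> * Y \<omega>) \<omega> =
      f z \<omega> * cond_E M L (\<lambda>\<omega>. mu 1 \<omega> * p z \<omega> + mu (-1) \<omega> * (1 - p z \<omega>)) \<omega>"
proof -
  let ?I = "\<lambda>a. indicat_real {\<omega> \<in> space M. A \<omega> = a \<and> Z \<omega> = z}"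
  let ?IY = "\<lambda>\<omega>. indicat_real {\<omega> \<in> space M. Z \<omega> = z} \<omega> * Y \<omega>"
  let ?s = "\<lambda>\<omega>. ?I 1 \<omega> * Yza z 1 \<omega> + ?I (-1) \<omega> * Yza z (-1) \<omega>"
  let ?g = "\<lambda>\<omega>. mu 1 \<omega> * p z \<omega> + mu (-1) \<omega> * (1 - p z \<omega>)"
  have ints: "integrable M (\<lambda>\<omega>. ?I a \<omega> * Yza z a \<omega>)" if "a \<in> {-1, 1}" for a
    using integrable_mult_indicator[of "{\<omega> \<in> space M. A \<omega> = a \<and> Z \<omega> = z}" M "Yza z a"]
      Yza_integrable z that by auto
  have s: "integrable M ?s" using ints by (intro Bochner_Integration.integrable_add) auto
  have eq: "AE \<omega> in M. ?IY \<omega> = ?s \<omega>"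
    using consistency AE_space
  proof eventually_elim
    case (elim \<omega>)
    then have "A \<omega> = 1 \<or> A \<omega> = -1" using A_values by auto
    then show ?case using elim by (auto simp: indicator_def)
  qed
  show IY: "integrable M ?IY"
    by (rule integrable_cong_AE_imp[OF s _ AE_symmetric[OF eq]]) measurable
  have "AE \<omega> in M. cond_E M LU ?IY \<omega> = cond_E M LU ?s \<omega>"
    unfolding cond_E_def using eq s by (intro FLU.real_cond_exp_cong) auto
  moreover have "AE \<omega> in M. cond_E M LU ?s \<omega> =
      cond_E M LU (\<lambda>\<omega>. ?I 1 \<omega> * Yza z 1 \<omega>) \<omega> + cond_E M LU (\<lambda>\<omega>. ?I (-1) \<omega> * Yza z (-1) \<omega>) \<omega>"
    unfolding cond_E_def using ints by (intro FLU.real_cond_exp_add) auto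
  ultimately have "AE \<omega> in M. cond_E M LU ?IY \<omega> = f z \<omega> * ?g \<omega>"
    using cond_E_indicator_Yza[OF z binary_values(1)] cond_E_indicator_Yza[OF z binary_values(2)]
      q_eq(1)[OF z]
    by eventually_elim (simp add: algebra_simps)
  then have "AE \<omega> in M. real_cond_exp M FL (cond_E M LU ?IY) \<omega> = real_cond_exp M FL (\<lambda>\<omega>. f z \<omega> * ?g \<omega>) \<omega>"
    by (intro FL.real_cond_exp_cong) auto
  moreover have "AE \<omega> in M. real_cond_exp M FL (cond_E M LU ?IY) \<omega> = cond_E M L ?IY \<omega>"
    unfolding cond_E_def
    by (intro FL.real_cond_exp_nested_subalg FLU.subalg FL_subalgebra_FLU IY)
  moreover have "AE \<omega> in M. real_cond_exp M FL (\<lambda>\<omega>. f z \<omega> * ?g \<omega>) \<omega> = f z \<omega> * cond_E M L ?g \<omega>"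
    unfolding cond_E_def[of M L ?g]
    by (rule FL.real_cond_exp_mult_F_meas[OF _ mixture_integrable[OF z]]) measurable
  ultimately show "AE \<omega> in M. cond_E M L ?IY \<omega> = f z \<omega> * cond_E M L ?g \<omega>"
    by eventually_elim simp
qed

lemma iv_prob_eq:
  "\<omega> \<in> space M \<Longrightarrow> iv_prob M Z L \<omega> = (if Z \<omega> = 1 then f 1 \<omega> else f (-1) \<omega>)"
  using Z_values by (auto simp: iv_prob_def)

text \<open>The weight cancels \<open>f\<close>, leaving the difference of the mixtures for
  \<open>z = 1\<close> and \<open>z = -1\<close>. As the mixing weights of each sum to 1, this
  difference is the product of the latent effect and the latent propensity difference.\<close>

lemma gamma_weighted:
  assumes X: "integrable M (X 1)" "integrable M (X (-1))"
    and eq: "\<And>\<omega>. \<omega> \<in> space M \<Longrightarrow>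
      X 1 \<omega> - X (-1) \<omega> = Z \<omega> * Y \<omega> / (delta M A Z L \<omega> * iv_prob M Z L \<omega>)"
  shows "AE \<omega> in M. gamma M X L \<omega> =
    cond_E M L (\<lambda>\<omega>. gamma M Ya LU \<omega> * delta M A Z LU \<omega>) \<omega> / delta M A Z L \<omega>"
proof -
  let ?d = "delta M A Z L"
  let ?I = "\<lambda>z. indicat_real {\<omega> \<in> space M. Z \<omega> = z}"
  let ?h = "\<lambda>z \<omega>. 1 / (?d \<omega> * f z \<omega>) * (?I z \<omega> * Y \<omega>)"
  let ?g = "\<lambda>z \<omega>. mu 1 \<omega> * p z \<omega> + mu (-1) \<omega> * (1 - p z \<omega>)"
  have X12: "integrable M (\<lambda>\<omega>. X 1 \<omega> - X (-1) \<omega>)" using X by simp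
  have h: "integrable M (?h z)" if z: "z \<in> {-1, 1}" for z
  proof -
    \<comment> \<open>The weight is unbounded, so integrability of \<open>?h z\<close> comes from
      that of the contrast: restricting to \<open>Z = z\<close> and multiplying by \<open>z\<close>
      undoes the factor \<open>Z\<close>.\<close>
    have "integrable M (\<lambda>\<omega>. (X 1 \<omega> - X (-1) \<omega>) * (z * ?I z \<omega>))"
      using z by (intro integrable_mult_bounded X12) (auto simp: indicator_def)
    moreover have "(X 1 \<omega> - X (-1) \<omega>) * (z * ?I z \<omega>) = ?h z \<omega>" if "\<omega> \<in> space M" for \<omega>
      using z that by (auto simp: eq iv_prob_eq indicator_def)
    ultimately show ?thesis by (simp cong: Bochner_Integration.integrable_cong)
  qed
  have "AE \<omega> in M. gamma M X L \<omega> = real_cond_exp M FL (\<lambda>\<omega>. ?h 1 \<omega> - ?h (-1) \<omega>) \<omega>"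
    unfolding gamma_def cond_E_def using X Z_values
    by (intro FL.real_cond_exp_cong AE_I2) (auto simp: eq iv_prob_eq indicator_def)
  moreover have "AE \<omega> in M. real_cond_exp M FL (\<lambda>\<omega>. ?h 1 \<omega> - ?h (-1) \<omega>) \<omega> =
      real_cond_exp M FL (?h 1) \<omega> - real_cond_exp M FL (?h (-1)) \<omega>"
    by (intro FL.real_cond_exp_diff h) auto
  moreover have hz: "AE \<omega> in M. real_cond_exp M FL (?h z) \<omega> = cond_E M L (?g z) \<omega> / ?d \<omega>"
    if z: "z \<in> {-1, 1}" for z
  proof -
    have "AE \<omega> in M. real_cond_exp M FL (?h z) \<omega> =
        1 / (?d \<omega> * f z \<omega>) * cond_E M L (\<lambda>\<omega>. ?I z \<omega> * Y \<omega>) \<omega>"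
      unfolding cond_E_def[of M L "\<lambda>\<omega>. ?I z \<omega> * Y \<omega>"]
      by (rule FL.real_cond_exp_mult_F_meas[OF _ cond_E_indicator_Y(1)[OF z]]) measurable
    then show ?thesis
      using cond_E_indicator_Y(2)[OF z] f_pos[OF z] by eventually_elim simp
  qed
  note hz[OF binary_values(1)] hz[OF binary_values(2)]
  moreover have "AE \<omega> in M. cond_E M L (\<lambda>\<omega>. ?g 1 \<omega> - ?g (-1) \<omega>) \<omega> =
      cond_E M L (?g 1) \<omega> - cond_E M L (?g (-1)) \<omega>"
    unfolding cond_E_def[of M L] by (intro FL.real_cond_exp_diff mixture_integrable) auto
  moreover have "AE \<omega> in M. cond_E M L (\<lambda>\<omega>. ?g 1 \<omega> - ?g (-1) \<omega>) \<omega> =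
      cond_E M L (\<lambda>\<omega>. gamma M Ya LU \<omega> * delta M A Z LU \<omega>) \<omega>"
    unfolding cond_E_def[of M L]
  proof (rule FL.real_cond_exp_cong)
    show "AE \<omega> in M. ?g 1 \<omega> - ?g (-1) \<omega> = gamma M Ya LU \<omega> * delta M A Z LU \<omega>"
      using gamma_LU_eq
    proof eventually_elim
      case (elim \<omega>)
      show ?case unfolding elim delta_def by (simp add: algebra_simps)
    qed
  qed (use gamma_LU_integrable in auto)
  ultimately show ?thesis by eventually_elim (simp add: diff_divide_distrib)
qed

section \<open>From the two optimization problems to the sign and covariance conditions\<close>

text \<open>An integrand depending on the regime only through its value at \<open>L\<close> is the
  regime outcome of the two arms given by the constant regimes. This covers (P1) and (P2) at
  once.\<close>

lemma weighted_identifies_iff: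
  assumes gamma_nonzero: "AE \<omega> in M. gamma M Ya L \<omega> \<noteq> 0"
    and iv_relevance: "AE \<omega> in M. delta M A Z L \<omega> \<noteq> 0"
    and P: "\<forall>D\<in>regimes. integrable M (P D)"
    and split: "\<And>D \<omega>. D \<in> regimes \<Longrightarrow> \<omega> \<in> space M \<Longrightarrow>
      P D \<omega> = regime_outcome (\<lambda>a. P (\<lambda>_. a)) L D \<omega>"
    and contrast: "\<And>\<omega>. \<omega> \<in> space M \<Longrightarrow>
      P (\<lambda>_. 1) \<omega> - P (\<lambda>_. -1) \<omega> = Z \<omega> * Y \<omega> / (delta M A Z L \<omega> * iv_prob M Z L \<omega>)"
  shows "identifies_optimal_regime M Ya L (\<lambda>D. LINT \<omega>|M. P D \<omega>) \<longleftrightarrow>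
    (AE \<omega> in M. cond_E M L (\<lambda>\<omega>. gamma M Ya LU \<omega> * delta M A Z LU \<omega>) \<omega> /
      (gamma M Ya L \<omega> * delta M A Z L \<omega>) > 0)"
proof -
  let ?X = "\<lambda>a. P (\<lambda>_. a)"
  have X: "integrable M (?X 1)" "integrable M (?X (-1))"
    using P by (auto simp: regimes_def)
  have "(LINT \<omega>|M. P D \<omega>) = (LINT \<omega>|M. regime_outcome ?X L D \<omega>)" if "D \<in> regimes" for D
    using split[OF that] by (rule Bochner_Integration.integral_cong[OF refl])
  then have "arg_maxima (\<lambda>D. LINT \<omega>|M. P D \<omega>) = arg_maxima (\<lambda>D. LINT \<omega>|M. regime_outcome ?X L D \<omega>)"
    by (auto simp: arg_maxima_def)
  then have "identifies_optimal_regime M Ya L (\<lambda>D. LINT \<omega>|M. P D \<omega>) \<longleftrightarrow>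
      identifies_optimal_regime M Ya L (\<lambda>D. LINT \<omega>|M. regime_outcome ?X L D \<omega>)"
    by (simp add: identifies_optimal_regime_def)
  also have "\<dots> \<longleftrightarrow> (AE \<omega> in M. gamma M ?X L \<omega> * gamma M Ya L \<omega> > 0)"
    using Ya_integrable gamma_nonzero X
    by (intro identifies_optimal_regime_iff finite_measure_axioms) auto
  also have "\<dots> \<longleftrightarrow> (AE \<omega> in M. cond_E M L (\<lambda>\<omega>. gamma M Ya LU \<omega> * delta M A Z LU \<omega>) \<omega> /
      (gamma M Ya L \<omega> * delta M A Z L \<omega>) > 0)"
  proof (rule eventually_subst)
    have "AE \<omega> in M. gamma M ?X L \<omega> = cond_E M L (\<lambda>\<omega>. gamma M Ya LU \<omega> * delta M A Z LU \<omega>) \<omega> / delta M A Z L \<omega>"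
      by (rule gamma_weighted[OF X contrast])
    then show "AE \<omega> in M. (gamma M ?X L \<omega> * gamma M Ya L \<omega> > 0) =
      (cond_E M L (\<lambda>\<omega>. gamma M Ya LU \<omega> * delta M A Z LU \<omega>) \<omega> /
        (gamma M Ya L \<omega> * delta M A Z L \<omega>) > 0)"
      using gamma_nonzero iv_relevance
    proof eventually_elim
      case (elim \<omega>)
      \<comment> \<open>Multiplying and dividing by \<open>g\<close> differ by the positive factor
        \<open>g\<^sup>2\<close>.\<close>
      have "c / d * g > 0 \<longleftrightarrow> c / (g * d) > 0" if "g \<noteq> 0" for c d g :: real
      proof -
        have eq: "c / d * g = c / (g * d) * g\<^sup>2"
          using that by (simp add: field_simps power2_eq_square)
        show ?thesis unfolding eq zero_less_mult_iff[of "c / (g * d)"] using that by simp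
      qed
      then show ?case using elim by simp
    qed
  qed
  finally show ?thesis .
qed

end

theorem theorem3p1:
  fixes M :: "'w measure"
    and Y A Z :: "'w \<Rightarrow> real"
    and L :: "'w \<Rightarrow> 'l::polish_space"
    and U :: "'w \<Rightarrow> 'u::polish_space"
    and Yza :: "real \<Rightarrow> real \<Rightarrow> 'w \<Rightarrow> real"
    and Ya :: "real \<Rightarrow> 'w \<Rightarrow> real"
  defines "LU \<equiv> \<lambda>\<omega>. (L \<omega>, U \<omega>)"
  assumes "prob_space M"
    and "Y \<in> borel_measurable M"
    and "L \<in> borel_measurable M"
    and "U \<in> borel_measurable M"
    and "A \<in> borel_measurable M" and "\<forall>\<omega>\<in>space M. A \<omega> \<in> {-1, 1}"
    and "Z \<in> borel_measurable M" and "\<forall>\<omega>\<in>space M. Z \<omega> \<in> {-1, 1}"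
    and Yza_integrable: "\<forall>z\<in>{-1, 1}. \<forall>a\<in>{-1, 1}. integrable M (Yza z a)"
    and Ya_integrable: "\<forall>a\<in>{-1, 1}. integrable M (Ya a)"
    and P1_integrable: "\<forall>D\<in>regimes. integrable M (P1_integrand M Y A Z L D)"
    and P2_integrable: "\<forall>D\<in>regimes. integrable M (P2_integrand M Y A Z L D)"
    and consistency_za: "AE \<omega> in M. Y \<omega> = Yza (Z \<omega>) (A \<omega>) \<omega>"
    and consistency_a: "AE \<omega> in M. Y \<omega> = Ya (A \<omega>) \<omega>"
    and positivity: "\<forall>a\<in>{-1, 1}. AE \<omega> in M. cond_Pr M L (\<lambda>\<omega>. A \<omega> = a) \<omega> > 0"
    and gamma_nonzero: "AE \<omega> in M. gamma M Ya L \<omega> \<noteq> 0"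
    and latent_unconfoundedness:
      "\<forall>z\<in>{-1, 1}. \<forall>a\<in>{-1, 1}. cond_indep M LU (Yza z a) (\<lambda>\<omega>. (Z \<omega>, A \<omega>))"
    and iv_relevance: "AE \<omega> in M. delta M A Z L \<omega> \<noteq> 0"
    and exclusion_restriction:
      "\<forall>z\<in>{-1, 1}. \<forall>a\<in>{-1, 1}. AE \<omega> in M. Yza z a \<omega> = Ya a \<omega>"
    and iv_independence: "cond_indep M L Z U"
    and iv_positivity:
      "AE \<omega> in M. 0 < cond_Pr M L (\<lambda>\<omega>. Z \<omega> = 1) \<omega> \<and> cond_Pr M L (\<lambda>\<omega>. Z \<omega> = 1) \<omega> < 1"
  defines "gamma_ratio \<equiv> \<lambda>\<omega>. gamma M Ya LU \<omega> / gamma M Ya L \<omega>"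
    and "delta_ratio \<equiv> \<lambda>\<omega>. delta M A Z LU \<omega> / delta M A Z L \<omega>"
  shows
    "(identifies_optimal_regime M Ya L (\<lambda>D. LINT \<omega>|M. P1_integrand M Y A Z L D \<omega>)
        \<longleftrightarrow> (AE \<omega> in M. cond_E M L (\<lambda>\<omega>. gamma_ratio \<omega> * delta_ratio \<omega>) \<omega> > 0)) \<and>
     (identifies_optimal_regime M Ya L (\<lambda>D. LINT \<omega>|M. P2_integrand M Y A Z L D \<omega>)
        \<longleftrightarrow> (AE \<omega> in M. cond_E M L (\<lambda>\<omega>. gamma_ratio \<omega> * delta_ratio \<omega>) \<omega> > 0)) \<and>
     ((AE \<omega> in M. cond_E M L (\<lambda>\<omega>. gamma_ratio \<omega> * delta_ratio \<omega>) \<omega> > 0)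
        \<longleftrightarrow> (AE \<omega> in M. cond_Cov M L gamma_ratio delta_ratio \<omega> > -1))"
proof -
  interpret iv: latent_iv_model M Y A Z L U Yza Ya
    by (intro latent_iv_model.intro latent_iv_model_axioms.intro;
        use assms in \<open>simp only: LU_def\<close>)
  \<comment> \<open>The common quantity: the mean of the product of ratios is \<open>c\<close>,
    their covariance is \<open>c - 1\<close>, and both problems reduce to
    \<open>c > 0\<close>.\<close>
  define c where "c = (\<lambda>\<omega>. cond_E M L (\<lambda>\<omega>. gamma M Ya LU \<omega> * delta M A Z LU \<omega>) \<omega> /
    (gamma M Ya L \<omega> * delta M A Z L \<omega>))"
  have mean: "AE \<omega> in M. cond_E M L (\<lambda>\<omega>. gamma_ratio \<omega> * delta_ratio \<omega>) \<omega> = c \<omega>"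
    and cov: "AE \<omega> in M. cond_Cov M L gamma_ratio delta_ratio \<omega> = c \<omega> - 1"
    unfolding c_def gamma_ratio_def delta_ratio_def LU_def cond_Cov_def cond_E_def
    by (rule iv.FL.real_cond_exp_ratio_covariance[OF iv.gamma_LU_integrable iv.delta_LU_integrable
          iv.delta_LU_bounded _ iv.delta_measurable(1) iv.cond_E_gamma_LU[unfolded cond_E_def]
          iv.cond_E_delta_LU[unfolded cond_E_def] gamma_nonzero iv_relevance],
        simp add: gamma_def cond_E_def)+
  have mean_iff: "(AE \<omega> in M. cond_E M L (\<lambda>\<omega>. gamma_ratio \<omega> * delta_ratio \<omega>) \<omega> > 0) \<longleftrightarrow>
      (AE \<omega> in M. c \<omega> > 0)"
    by (rule eventually_subst) (use mean in \<open>auto elim: eventually_mono\<close>)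
  have cov_iff: "(AE \<omega> in M. cond_Cov M L gamma_ratio delta_ratio \<omega> > -1) \<longleftrightarrow>
      (AE \<omega> in M. c \<omega> > 0)"
    by (rule eventually_subst) (use cov in \<open>auto elim: eventually_mono\<close>)
  have dich: "A \<omega> = 1 \<or> A \<omega> = -1" "Z \<omega> = 1 \<or> Z \<omega> = -1" if "\<omega> \<in> space M" for \<omega>
    using iv.A_values iv.Z_values that by auto
  have reg: "D l = 1 \<or> D l = -1" if "D \<in> regimes" for D :: "'l \<Rightarrow> real" and l
    using that by (auto simp: regimes_def)
  have P1: "identifies_optimal_regime M Ya L (\<lambda>D. LINT \<omega>|M. P1_integrand M Y A Z L D \<omega>)
      \<longleftrightarrow> (AE \<omega> in M. c \<omega> > 0)"
    unfolding c_def LU_def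
  proof (rule iv.weighted_identifies_iff[OF gamma_nonzero iv_relevance P1_integrable])
    fix D \<omega> assume "D \<in> (regimes :: ('l \<Rightarrow> real) set)" "\<omega> \<in> space M"
    then show "P1_integrand M Y A Z L D \<omega> =
        regime_outcome (\<lambda>a. P1_integrand M Y A Z L (\<lambda>_. a)) L D \<omega>"
      using reg[of D "L \<omega>"] by (auto simp: P1_integrand_def regime_outcome_def)
  next
    fix \<omega> assume "\<omega> \<in> space M"
    \<comment> \<open>The indicators of \<open>A = 1\<close> and \<open>A = -1\<close> differ by
      \<open>A\<close>, and \<open>A * A = 1\<close> removes the treatment from the
      contrast.\<close>
    then show "P1_integrand M Y A Z L (\<lambda>_. 1) \<omega> - P1_integrand M Y A Z L (\<lambda>_. -1) \<omega> =
        Z \<omega> * Y \<omega> / (delta M A Z L \<omega> * iv_prob M Z L \<omega>)"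
      using dich(1)[of \<omega>] by (auto simp: P1_integrand_def)
  qed
  have P2: "identifies_optimal_regime M Ya L (\<lambda>D. LINT \<omega>|M. P2_integrand M Y A Z L D \<omega>)
      \<longleftrightarrow> (AE \<omega> in M. c \<omega> > 0)"
    unfolding c_def LU_def
  proof (rule iv.weighted_identifies_iff[OF gamma_nonzero iv_relevance P2_integrable])
    fix D \<omega> assume "D \<in> (regimes :: ('l \<Rightarrow> real) set)" "\<omega> \<in> space M"
    then show "P2_integrand M Y A Z L D \<omega> =
        regime_outcome (\<lambda>a. P2_integrand M Y A Z L (\<lambda>_. a)) L D \<omega>"
      using reg[of D "L \<omega>"] by (auto simp: P2_integrand_def regime_outcome_def)
  next
    fix \<omega> assume "\<omega> \<in> space M"
    \<comment> \<open>Here the difference of the indicators supplies the factor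
      \<open>Z\<close>.\<close>
    then show "P2_integrand M Y A Z L (\<lambda>_. 1) \<omega> - P2_integrand M Y A Z L (\<lambda>_. -1) \<omega> =
        Z \<omega> * Y \<omega> / (delta M A Z L \<omega> * iv_prob M Z L \<omega>)"
      using dich(2)[of \<omega>] by (auto simp: P2_integrand_def)
  qed
  show ?thesis using P1 P2 mean_iff cov_iff by blast
qed

end
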